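(* Let $Q$ be a real, symmetric, positive definite $n\times n$ matrix and let $B$ be a real $n\times n$ matrix all of whose eigenvalues have negative real parts. The Ornstein--Uhlenbeck maximal operator $\mathcal H_*f(x)=\sup_{t>0}|\mathcal H_tf(x)|$ is bounded on $L^p(\gamma_\infty)$ for all $p>1$.
   Context: For $0<t\le+\infty$ let $Q_t=\int_0^t e^{sB}Qe^{sB^*}\,ds$, a symmetric positive definite matrix, and let $\gamma_t$ be the Gaussian probability measure on $\mathbb R^n$ with density $y\mapsto(2\pi)^{-n/2}(\det Q_t)^{-1/2}\exp\left(-\frac12\langle Q_t^{-1}y,y\rangle\right)$ with respect to Lebesgue measure. The Ornstein--Uhlenbeck semigroup $(\mathcal H_t)_{t>0}$ with covariance $Q$ and drift $B$ is given by Kolmogorov's formula $\mathcal H_tf(x)=\int f(e^{tB}x-y)\,d\gamma_t(y)$, $x\in\mathbb R^n$, for bounded continuous $f$. Equivalently, $\mathcal H_tf(x)=\int K_t(x,u)f(u)\,d\gamma_\infty(u)$, an absolutely convergent integral for every $f\in L^1(\gamma_\infty)$, $t>0$, $x\in\mathbb R^n$, which defines $\mathcal H_tf$ for $f\in L^1(\gamma_\infty)$. Here the Mehler kernel is $$K_t(x,u)=\Big(\frac{\det Q_\infty}{\det Q_t}\Big)^{1/2}\exp(R(x))\exp\Big[-\tfrac12\big\langle(Q_t^{-1}-Q_\infty^{-1})(u-D_tx),\,u-D_tx\big\rangle\Big],$$ with $R(x)=\frac12\langle Q_\infty^{-1}x,x\rangle$ and $D_t=Q_\infty e^{-tB^*}Q_\infty^{-1}$.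 The measure $\gamma_\infty$ is invariant under $\mathcal H_t$. *)

theory Defs
  imports "HOL-Probability.Essential_Supremum" "HOL-Analysis.Analysis"
begin

(* The type-class product on real^'n^'n is entrywise, so powers are taken with the matrix product. *)
definition mat_exp :: "real^'n^'n \<Rightarrow> real^'n^'n" where
  "mat_exp A = (\<Sum>k. (1 / fact k) *\<^sub>R (((**) A) ^^ k) (mat 1))"

definition sym_pos_def :: "real^'n^'n \<Rightarrow> bool" where
  "sym_pos_def A \<longleftrightarrow> transpose A = A \<and> (\<forall>x. x \<noteq> 0 \<longrightarrow> 0 < (A *v x) \<bullet> x)"

(* Complex eigenvalues of a real matrix. *)
definition eigenvalue_of :: "real^'n^'n \<Rightarrow> complex \<Rightarrow> bool" where
  "eigenvalue_of A z \<longleftrightarrow>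
     (\<exists>v :: complex^'n. v \<noteq> 0 \<and> (\<chi> i j. complex_of_real (A $ i $ j)) *v v = z *s v)"

(* Q_t for 0 < t <= infinity; for t = infinity the domain of integration is {0..}. *)
definition ou_cov :: "real^'n^'n \<Rightarrow> real^'n^'n \<Rightarrow> ereal \<Rightarrow> real^'n^'n" where
  "ou_cov Q B t = integral {s::real. 0 \<le> s \<and> ereal s \<le> t}
     (\<lambda>s. mat_exp (s *\<^sub>R B) ** Q ** mat_exp (s *\<^sub>R transpose B))"

definition ou_gauss :: "real^'n^'n \<Rightarrow> real^'n^'n \<Rightarrow> ereal \<Rightarrow> (real^'n) measure" where
  "ou_gauss Q B t = density lborel (\<lambda>y. ennreal
     ((2 * pi) powr (- real CARD('n) / 2) * det (ou_cov Q B t) powr (- 1 / 2) *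
      exp (- (1 / 2) * ((matrix_inv (ou_cov Q B t) *v y) \<bullet> y))))"

definition ou_D :: "real^'n^'n \<Rightarrow> real^'n^'n \<Rightarrow> real \<Rightarrow> real^'n^'n" where
  "ou_D Q B t =
     ou_cov Q B \<infinity> ** mat_exp (- (t *\<^sub>R transpose B)) ** matrix_inv (ou_cov Q B \<infinity>)"

definition ou_R :: "real^'n^'n \<Rightarrow> real^'n^'n \<Rightarrow> real^'n \<Rightarrow> real" where
  "ou_R Q B x = (1 / 2) * ((matrix_inv (ou_cov Q B \<infinity>) *v x) \<bullet> x)"

definition mehler_kernel ::
    "real^'n^'n \<Rightarrow> real^'n^'n \<Rightarrow> real \<Rightarrow> real^'n \<Rightarrow> real^'n \<Rightarrow> real" where
  "mehler_kernel Q B t x u =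
     sqrt (det (ou_cov Q B \<infinity>) / det (ou_cov Q B (ereal t))) * exp (ou_R Q B x) *
     exp (- (1 / 2) *
       (((matrix_inv (ou_cov Q B (ereal t)) - matrix_inv (ou_cov Q B \<infinity>)) *v
         (u - ou_D Q B t *v x)) \<bullet> (u - ou_D Q B t *v x)))"

(* The semigroup on L^1(gamma_infinity).  For bounded continuous f this integral agrees with
   Kolmogorov's formula, the integral of f(e^{tB} x - y) with respect to gamma_t(y). *)
definition ou_semigroup ::
    "real^'n^'n \<Rightarrow> real^'n^'n \<Rightarrow> real \<Rightarrow> (real^'n \<Rightarrow> complex) \<Rightarrow> real^'n \<Rightarrow> complex" where
  "ou_semigroup Q B t f x =
     (LINT u|ou_gauss Q B \<infinity>. mehler_kernel Q B t x u *\<^sub>R f u)"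

definition ou_maximal ::
    "real^'n^'n \<Rightarrow> real^'n^'n \<Rightarrow> (real^'n \<Rightarrow> complex) \<Rightarrow> real^'n \<Rightarrow> ennreal" where
  "ou_maximal Q B f x = (SUP t\<in>{0<..}. ennreal (norm (ou_semigroup Q B t f x)))"

(* Power with a positive real exponent on [0, infinity]. *)
definition ennpow :: "ennreal \<Rightarrow> real \<Rightarrow> ennreal" where
  "ennpow a r = (if a = top then top else ennreal (enn2real a powr r))"

definition Lp_norm :: "ennreal \<Rightarrow> 'a measure \<Rightarrow> ('a \<Rightarrow> ennreal) \<Rightarrow> ennreal" where
  "Lp_norm p M g =
     (if p = top then esssup M g
      else ennpow (\<integral>\<^sup>+x. ennpow (g x) (enn2real p) \<partial>M) (1 / enn2real p))"

(* T takes values in the [0, infinity]-valued functions because a maximal function may be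
   infinite at some points; the bound forces T f to be finite almost everywhere. *)
definition bounded_on_Lp ::
    "ennreal \<Rightarrow> 'a measure \<Rightarrow> (('a \<Rightarrow> complex) \<Rightarrow> 'a \<Rightarrow> ennreal) \<Rightarrow> bool" where
  "bounded_on_Lp p M T \<longleftrightarrow>
     (\<exists>C::real. \<forall>f. f \<in> borel_measurable M \<longrightarrow> Lp_norm p M (\<lambda>x. ennreal (norm (f x))) < top \<longrightarrow>
        T f \<in> borel_measurable M \<and>
        Lp_norm p M (T f) \<le> ennreal C * Lp_norm p M (\<lambda>x. ennreal (norm (f x))))"

end

theory Submission
  imports Defs "HOL-Computational_Algebra.Fundamental_Theorem_Algebra"
begin

text \<open>Write \<open>S = Q_\<infinity>\<close>, \<open>P = Q_t\<close>, \<open>M = exp (t B)\<close>, \<open>\<tau> = min 1 t\<close>. The kernel of \<open>H_t\<close> with respect to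
  Lebesgue measure is a constant of order \<open>\<tau>\<close> to the power \<open>-n/2\<close> times \<open>exp (- E)\<close>, where
  \<open>2 E = \<langle>P\<inverse> (y - M x), y - M x\<rangle>\<close>, and \<open>E = R y - R x + F\<close> with \<open>F \<ge> 0\<close>. Conjugating
  with \<open>exp (- R / p)\<close>, which maps \<open>L\<^sup>p(\<gamma>\<^sub>\<infinity>)\<close> onto \<open>L\<^sup>p(dx)\<close>, replaces \<open>E\<close> by \<open>(1 - 1/p) E + F/p\<close>. For
  \<open>1 < p < \<infinity>\<close> this form dominates \<open>|x - y|\<^sup>2 / \<tau>\<close>, because \<open>E\<close> and \<open>F\<close> are minimal at
  \<open>y = M x\<close> and \<open>y = D_t x\<close>, two points at distance at least of order \<open>\<tau> |x|\<close>. So the conjugated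
  maximal operator is bounded
  pointwise by the Hardy-Littlewood maximal function. For \<open>p = \<infinity>\<close> the Gaussian bound by \<open>E\<close> alone
  suffices.\<close>

section \<open>The matrix exponential\<close>

text \<open>The spectral hypothesis enters through exponential decay of \<open>M t\<close>, which
  makes the integral \<open>S\<close> converge and gives the splitting
  \<open>S = P + M S M^T\<close>. The estimates rest on two consequences of this identity.
  Completing squares with it gives \<open>E = R y - R x + F\<close>. Read on quadratic forms, it
  says that \<open>M t\<close> contracts \<open>R\<close> by a factor \<open>1 - b\<close> with
  \<open>b\<close> of order \<tau>, because \<open>P\<close> dominates a multiple of \<tau>
  \<open>S\<close>.

  The obstacle is the drift: \<open>E\<close> controls \<open>h = y - M x\<close>, while
  \<open>x - y\<close> also contains the displacement \<open>M x - x\<close> of order \<tau> |x|,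
  about which \<open>E\<close> says nothing. The contraction makes the gap between the two minima
  quantitative: up to a multiple of |h|^2 / \<tau>, \<open>R y - R x\<close> is at most minus a
  constant times \<tau> |x|^2. That error is paid for by the share \<open>(1 - 1/p) E\<close>, and
  the gain in |x|^2 comes from a share of \<open>F\<close>, so both weights must be positive. For
  \<open>p = \<infinity>\<close> the Gaussian may stay centred at \<open>M x\<close>, since only its
  mass matters. All constants are uniform in \<open>t\<close>, because every bound is expressed
  through \<tau>; this is what allows a supremum over all times at once.\<close>

lemma bounded_bilinear_matrix_mult:
  "bounded_bilinear (\<lambda>(A::real^'m^'n) (B::real^'k^'m). A ** B)"
proof -
  have "bilinear (\<lambda>(A::real^'m^'n) (B::real^'k^'m). A ** B)"
    by (auto simp: bilinear_def matrix_matrix_mult_def vec_eq_iff sum.distrib sum_distrib_left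
        algebra_simps intro!: linearI)
  then show ?thesis by (simp add: bilinear_conv_bounded_bilinear)
qed

lemma bounded_bilinear_matrix_vector_mult:
  "bounded_bilinear (\<lambda>(A::real^'m^'n) (x::real^'m). A *v x)"
proof -
  have "bilinear (\<lambda>(A::real^'m^'n) (x::real^'m). A *v x)"
    by (auto simp: bilinear_def matrix_vector_mult_def vec_eq_iff sum.distrib sum_distrib_left
        algebra_simps intro!: linearI)
  then show ?thesis by (simp add: bilinear_conv_bounded_bilinear)
qed

lemma bounded_linear_transpose: "bounded_linear (transpose :: real^'n^'m \<Rightarrow> real^'m^'n)"
  unfolding linear_conv_bounded_linear[symmetric]
  by (auto simp: transpose_def vec_eq_iff intro!: linearI)

lemma has_derivative_componentwise_vec:
  fixes f :: "'a::real_normed_vector \<Rightarrow> ('b::euclidean_space)^'n"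
  assumes "\<And>i. ((\<lambda>x. f x $ i) has_derivative (\<lambda>h. f' h $ i)) (at x within S)"
  shows "(f has_derivative f') (at x within S)"
  unfolding has_derivative_componentwise_within[of f]
  using assms by (auto simp: Basis_vec_def inner_axis intro!: has_derivative_inner_left)

lemma has_vector_derivative_matrix:
  fixes f :: "real \<Rightarrow> real^'n^'m"
  assumes "\<And>i j. ((\<lambda>x. f x $ i $ j) has_real_derivative f' $ i $ j) (at x)"
  shows "(f has_vector_derivative f') (at x)"
  unfolding has_vector_derivative_def
proof (intro has_derivative_componentwise_vec)
  fix i j
  show "((\<lambda>x. f x $ i $ j) has_derivative (\<lambda>h. (h *\<^sub>R f') $ i $ j)) (at x)"
    using assms[of i j] unfolding has_field_derivative_def
    by (simp add: mult_commute_abs)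
qed

definition mat_pow :: "real^'n^'n \<Rightarrow> nat \<Rightarrow> real^'n^'n" where
  "mat_pow A k = ((**) A ^^ k) (mat 1)"

lemma mat_pow_0 [simp]: "mat_pow A 0 = mat 1"
  and mat_pow_Suc: "mat_pow A (Suc k) = A ** mat_pow A k"
  by (simp_all add: mat_pow_def)

lemma mat_pow_commute: "A ** mat_pow A k = mat_pow A k ** A"
  by (induction k) (simp, metis mat_pow_Suc matrix_mul_assoc)

lemma mat_pow_scaleR: "mat_pow (t *\<^sub>R A) k = t ^ k *\<^sub>R mat_pow A k"
  by (induction k) (simp_all add: mat_pow_Suc bounded_bilinear.scaleR_left[OF bounded_bilinear_matrix_mult]
      bounded_bilinear.scaleR_right[OF bounded_bilinear_matrix_mult])

lemma mat_pow_transpose: "transpose (mat_pow A k) = mat_pow (transpose A) k"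
proof (induction k)
  case (Suc k)
  have "transpose (mat_pow A (Suc k)) = transpose (mat_pow A k ** A)"
    by (simp add: mat_pow_Suc mat_pow_commute)
  then show ?case by (simp add: matrix_transpose_mul Suc mat_pow_Suc)
qed (simp add: transpose_mat)

text \<open>The norm of \<open>real^'n^'n\<close> is submultiplicative only up to a constant of the
  bilinear product; that constant is absorbed into the base of the geometric growth.\<close>

lemma mat_pow_bound:
  fixes A :: "real^'n^'n"
  obtains K where "K \<ge> 0" "\<And>k. norm (mat_pow A k) \<le> norm (mat 1 :: real^'n^'n) * K ^ k"
proof -
  obtain K where K: "K > 0" "\<And>(A::real^'n^'n) (B::real^'n^'n). norm (A ** B) \<le> norm A * norm B * K"
    using bounded_bilinear.pos_bounded[OF bounded_bilinear_matrix_mult] by blast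
  have "norm (mat_pow A k) \<le> norm (mat 1 :: real^'n^'n) * (K * norm A) ^ k" for k
  proof (induction k)
    case (Suc k)
    have "norm (mat_pow A (Suc k)) \<le> norm A * norm (mat_pow A k) * K"
      using K(2) by (simp add: mat_pow_Suc)
    also have "\<dots> \<le> norm A * (norm (mat 1 :: real^'n^'n) * (K * norm A) ^ k) * K"
      using Suc K(1) by (intro mult_right_mono mult_left_mono) auto
    finally show ?case by (simp add: algebra_simps)
  qed simp
  then show ?thesis by (rule that[rotated]) (use K(1) in simp)
qed

lemma summable_mat_exp:
  fixes A :: "real^'n^'n"
  shows "summable (\<lambda>k. (1 / fact k) *\<^sub>R mat_pow A k)"
proof -
  obtain K where K: "K \<ge> 0" "\<And>k. norm (mat_pow A k) \<le> norm (mat 1 :: real^'n^'n) * K ^ k"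
    using mat_pow_bound[of A] by metis
  show ?thesis
  proof (rule summable_comparison_test')
    show "summable (\<lambda>k. norm (mat 1 :: real^'n^'n) * (inverse (fact k) * K ^ k))"
      by (intro summable_mult summable_exp)
    fix k
    show "norm ((1 / fact k) *\<^sub>R mat_pow A k) \<le> norm (mat 1 :: real^'n^'n) * (inverse (fact k) * K ^ k)"
      using mult_left_mono[OF K(2)[of k], of "inverse (fact k)"]
      by (simp add: inverse_eq_divide mult.left_commute)
  qed
qed

lemma mat_exp_sums: "(\<lambda>k. (1 / fact k) *\<^sub>R mat_pow A k) sums mat_exp A"
  using summable_sums[OF summable_mat_exp] by (simp add: mat_exp_def mat_pow_def)

lemma mat_exp_0 [simp]: "mat_exp (0 :: real^'n^'n) = mat 1"
proof -
  have "(1 / fact k) *\<^sub>R mat_pow (0 :: real^'n^'n) k = (if k = 0 then mat 1 else 0)" for k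
    by (cases k) (simp_all add: mat_pow_Suc bounded_bilinear.zero_left[OF bounded_bilinear_matrix_mult])
  then have "(\<lambda>k. (1 / fact k) *\<^sub>R mat_pow (0 :: real^'n^'n) k) sums mat 1"
    using sums_single[of 0 "\<lambda>_. mat 1 :: real^'n^'n"] by simp
  then show ?thesis by (rule sums_unique2[OF mat_exp_sums])
qed

lemma mat_exp_transpose: "transpose (mat_exp A) = mat_exp (transpose A)"
proof -
  have "(\<lambda>k. transpose ((1 / fact k) *\<^sub>R mat_pow A k)) sums transpose (mat_exp A)"
    by (rule bounded_linear.sums[OF bounded_linear_transpose mat_exp_sums])
  moreover have "(\<lambda>k. transpose ((1 / fact k) *\<^sub>R mat_pow A k)) = (\<lambda>k. (1 / fact k) *\<^sub>R mat_pow (transpose A) k)"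
    by (simp add: transpose_scalar mat_pow_transpose)
  ultimately show ?thesis using sums_unique2[OF _ mat_exp_sums[of "transpose A"]] by simp
qed

lemma mat_exp_commute: "A ** mat_exp (t *\<^sub>R A) = mat_exp (t *\<^sub>R A) ** A"
proof -
  let ?f = "\<lambda>k. (1 / fact k) *\<^sub>R mat_pow (t *\<^sub>R A) k"
  have "(\<lambda>k. A ** ?f k) sums (A ** mat_exp (t *\<^sub>R A))"
    by (rule bounded_linear.sums[OF bounded_bilinear.bounded_linear_right[OF bounded_bilinear_matrix_mult] mat_exp_sums])
  moreover have "(\<lambda>k. ?f k ** A) sums (mat_exp (t *\<^sub>R A) ** A)"
    by (rule bounded_linear.sums[OF bounded_bilinear.bounded_linear_left[OF bounded_bilinear_matrix_mult] mat_exp_sums])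
  moreover have "(\<lambda>k. A ** ?f k) = (\<lambda>k. ?f k ** A)"
    by (simp add: mat_pow_scaleR bounded_bilinear.scaleR_left[OF bounded_bilinear_matrix_mult]
      bounded_bilinear.scaleR_right[OF bounded_bilinear_matrix_mult] mat_pow_commute)
  ultimately show ?thesis by (simp add: sums_unique2)
qed

text \<open>Each entry is a real power series in \<open>t\<close> with coefficients
  \<open>c\<close>, so scalar termwise differentiation applies; \<open>diffs c k\<close> is the
  corresponding entry of \<open>mat_pow A (Suc k)\<close> divided by \<open>fact k\<close>.\<close>

lemma has_vector_derivative_mat_exp:
  fixes A :: "real^'n^'n"
  shows "((\<lambda>t. mat_exp (t *\<^sub>R A)) has_vector_derivative A ** mat_exp (t *\<^sub>R A)) (at t)"
proof (rule has_vector_derivative_matrix)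
  fix i j
  define c where "c = (\<lambda>k. (mat_pow A k $ i $ j) / fact k)"
  have entry: "(\<lambda>k. (X k) $ i $ j) sums (Y $ i $ j)" if "X sums Y" for X and Y :: "real^'n^'n"
    using bounded_linear.sums[OF bounded_linear_vec_nth[of j]
        bounded_linear.sums[OF bounded_linear_vec_nth[of i] that]] .
  have sm: "(\<lambda>k. c k * s ^ k) sums (mat_exp (s *\<^sub>R A) $ i $ j)" for s
    using entry[OF mat_exp_sums[of "s *\<^sub>R A"]] by (simp add: mat_pow_scaleR c_def mult.commute)
  have "((\<lambda>s. \<Sum>k. c k * s ^ k) has_real_derivative (\<Sum>k. diffs c k * t ^ k)) (at t)"
    using sm by (intro termdiffs_strong_converges_everywhere) (rule sums_summable)
  moreover have "(\<lambda>s. \<Sum>k. c k * s ^ k) = (\<lambda>s. mat_exp (s *\<^sub>R A) $ i $ j)"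
    using sm by (auto simp: sums_iff)
  moreover have "(\<Sum>k. diffs c k * t ^ k) = (A ** mat_exp (t *\<^sub>R A)) $ i $ j"
  proof -
    have "(\<lambda>k. A ** ((1 / fact k) *\<^sub>R mat_pow (t *\<^sub>R A) k)) sums (A ** mat_exp (t *\<^sub>R A))"
      by (rule bounded_linear.sums[OF bounded_bilinear.bounded_linear_right[OF bounded_bilinear_matrix_mult] mat_exp_sums])
    from entry[OF this] have "(\<lambda>k. (t ^ k / fact k) * (mat_pow A (Suc k) $ i $ j)) sums ((A ** mat_exp (t *\<^sub>R A)) $ i $ j)"
      by (simp add: mat_pow_scaleR bounded_bilinear.scaleR_right[OF bounded_bilinear_matrix_mult] mat_pow_Suc)
    moreover have "(t ^ k / fact k) * (mat_pow A (Suc k) $ i $ j) = diffs c k * t ^ k" for k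
      by (simp add: diffs_def c_def field_simps del: of_nat_Suc)
    ultimately show ?thesis by (simp add: sums_iff)
  qed
  ultimately show "((\<lambda>s. mat_exp (s *\<^sub>R A) $ i $ j) has_real_derivative (A ** mat_exp (t *\<^sub>R A)) $ i $ j) (at t)"
    by simp
qed

lemma continuous_on_mat_exp: "continuous_on S (\<lambda>t. mat_exp (t *\<^sub>R A))"
  using has_vector_derivative_continuous[OF has_vector_derivative_mat_exp]
  by (auto intro!: continuous_at_imp_continuous_on)

lemma mat_exp_add:
  fixes A :: "real^'n^'n"
  shows "mat_exp ((s + t) *\<^sub>R A) = mat_exp (s *\<^sub>R A) ** mat_exp (t *\<^sub>R A)"
proof -
  define E where "E t = mat_exp (t *\<^sub>R A)" for t
  \<comment> \<open>Interpolates between the two sides: \<open>r = 0\<close> gives the exponential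
    of the sum, \<open>r = t\<close> the product. Its derivative vanishes because \<open>A\<close>
    commutes with its exponential.\<close>
  define X where "X r = E (s + t - r) ** E r" for r
  have E': "(E has_vector_derivative A ** E r) (at r)" for r
    unfolding E_def by (rule has_vector_derivative_mat_exp)
  have "(X has_vector_derivative 0) (at r)" for r
  proof -
    have "((\<lambda>r. s + t - r) has_vector_derivative - 1) (at r)"
      by (auto simp: has_real_derivative_iff_has_vector_derivative[symmetric]
          intro!: derivative_eq_intros)
    then have "((\<lambda>r. E (s + t - r)) has_vector_derivative (- 1) *\<^sub>R (A ** E (s + t - r))) (at r)"
      using vector_diff_chain_at[of "\<lambda>r. s + t - r" "-1" r E, OF _ E'] by (simp add: o_def)
    from bounded_bilinear.has_vector_derivative[OF bounded_bilinear_matrix_mult this E']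
    have "(X has_vector_derivative E (s + t - r) ** (A ** E r) + (- 1) *\<^sub>R (A ** E (s + t - r)) ** E r) (at r)"
      unfolding X_def .
    moreover have "A ** E (s + t - r) = E (s + t - r) ** A"
      unfolding E_def by (rule mat_exp_commute)
    ultimately show ?thesis
      by (simp add: bounded_bilinear.minus_left[OF bounded_bilinear_matrix_mult] matrix_mul_assoc)
  qed
  then obtain c where "\<And>r. X r = c"
    using has_vector_derivative_zero_constant[of UNIV X] by (metis UNIV_I convex_UNIV)
  then have "X 0 = X t" by simp
  then show ?thesis by (simp add: X_def E_def)
qed

lemma mat_exp_minus_mult: "mat_exp (t *\<^sub>R A) ** mat_exp (- (t *\<^sub>R A)) = mat 1"
  using mat_exp_add[of t "- t" A] by simp

section \<open>Exponential decay from the spectrum\<close>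

definition cmat :: "real^'n^'m \<Rightarrow> complex^'n^'m" where
  "cmat A = (\<chi> i j. complex_of_real (A $ i $ j))"

lemma cmat_mult: "cmat (A ** B) = cmat A ** cmat B"
  by (simp add: cmat_def matrix_matrix_mult_def vec_eq_iff)

lemma cmat_mat_1 [simp]: "cmat (mat 1 :: real^'n^'n) = mat 1"
  by (simp add: cmat_def mat_def vec_eq_iff)

lemma bounded_linear_cmat_vector: "bounded_linear (\<lambda>A::real^'n^'m. cmat A *v v)"
  unfolding linear_conv_bounded_linear[symmetric]
  by (auto simp: cmat_def matrix_vector_mult_def vec_eq_iff sum.distrib distrib_right scaleR_sum_right
      scaleR_conv_of_real[where 'a = complex] mult.assoc sum_distrib_left intro!: linearI)

lemma norm_vector_smult: "norm (c *s x) = norm c * norm (x :: complex^'n)"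
  by (simp add: norm_vec_def norm_mult L2_set_right_distrib)

lemma bounded_bilinear_vector_smult: "bounded_bilinear (\<lambda>c (x :: complex^'n). c *s x)"
proof (rule bounded_bilinear.intro)
  show "\<exists>K. \<forall>a b. norm (a *s (b :: complex^'n)) \<le> norm a * norm b * K"
    by (auto simp: norm_vector_smult intro!: exI[of _ 1])
qed (auto simp: vec_eq_iff algebra_simps)

text \<open>A dimension count, phrased for families because the iterates of a vector may repeat. A
  repetition is itself a relation, with coefficients 1 and -1.\<close>

lemma vector_sequence_dependent:
  fixes x :: "nat \<Rightarrow> complex^'n"
  obtains c where "\<exists>i\<le>CARD('n). c i \<noteq> 0" "(\<Sum>i\<le>CARD('n). c i *s x i) = 0"
proof (cases "inj_on x {..CARD('n)}")
  case True
  let ?S = "x ` {..CARD('n)}"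
  have "vec.dependent ?S"
  proof (rule ccontr)
    assume "vec.independent ?S"
    then have "card ?S \<le> CARD('n)"
      using vec.independent_card_le_dim[of ?S UNIV] vec_dim_card by (metis subset_UNIV)
    with True show False by (simp add: card_image)
  qed
  then obtain u where u: "(\<Sum>v\<in>?S. u v *s v) = 0" "\<exists>v\<in>?S. u v \<noteq> 0"
    by (auto simp: vec.dependent_finite)
  show ?thesis
    by (rule that[of "\<lambda>i. u (x i)"]) (use u True in \<open>auto simp: sum.reindex\<close>)
next
  case False
  then obtain i j where ij: "i \<le> CARD('n)" "j \<le> CARD('n)" "i \<noteq> j" "x i = x j"
    by (auto simp: inj_on_def)
  define c :: "nat \<Rightarrow> complex" where "c k = (if k = i then 1 else if k = j then - 1 else 0)" for k
  have "(\<Sum>k\<le>CARD('n). c k *s x k) = (\<Sum>k\<in>{i, j}. c k *s x k)"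
    by (rule sum.mono_neutral_right) (use ij in \<open>auto simp: c_def\<close>)
  also have "\<dots> = 0" using ij by (simp add: c_def vec_eq_iff)
  finally show ?thesis
    by (intro that[of c]) (use ij in \<open>auto simp: c_def\<close>)
qed

lemma funpow_linear:
  fixes A :: "complex^'n^'n"
  shows "(((*v) A) ^^ i) (x - c *s y) = (((*v) A) ^^ i) x - c *s (((*v) A) ^^ i) y"
  by (induction i) (simp_all add: matrix_vector_mult_diff_distrib vector_scalar_commute)

text \<open>With \<open>q(A) v\<close> written as a coefficient sum, this is
  \<open>((z - l) q)(A) v = q(A) (A v - l v)\<close>. The summation bound \<open>d\<close> is any
  bound on the degree, which suits an induction on \<open>d\<close>.\<close>

lemma poly_apply_linear_factor:
  fixes A :: "complex^'n^'n" and q :: "complex poly"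
  assumes "degree q \<le> d"
  shows "(\<Sum>i\<le>Suc d. coeff ([:- l, 1:] * q) i *s (((*v) A) ^^ i) v) =
         (\<Sum>i\<le>d. coeff q i *s (((*v) A) ^^ i) (A *v v - l *s v))"
proof -
  let ?P = "\<lambda>i. ((*v) A) ^^ i"
  have c: "coeff ([:- l, 1:] * q) i = coeff (pCons 0 q) i - l * coeff q i" for i
    by simp
  have "(\<Sum>i\<le>Suc d. coeff ([:- l, 1:] * q) i *s ?P i v) =
      (\<Sum>i\<le>Suc d. coeff (pCons 0 q) i *s ?P i v) - (\<Sum>i\<le>Suc d. (l * coeff q i) *s ?P i v)"
    unfolding c by (simp add: vec.scale_left_diff_distrib sum_subtractf del: sum.atMost_Suc)
  also have "(\<Sum>i\<le>Suc d. coeff (pCons 0 q) i *s ?P i v) = (\<Sum>i\<le>d. coeff q i *s ?P i (A *v v))"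
    by (subst sum.atMost_Suc_shift) (simp add: funpow_swap1)
  also have "(\<Sum>i\<le>Suc d. (l * coeff q i) *s ?P i v) = (\<Sum>i\<le>d. coeff q i *s (l *s ?P i v))"
    using assms by (simp add: coeff_eq_0 mult.commute)
  finally show ?thesis
    by (simp add: funpow_linear sum_subtractf vec.scale_right_diff_distrib)
qed

text \<open>Constant and rate may depend on the vector. This pointwise notion can be propagated
  through one factor \<open>B - l\<close> at a time, and complex vectors are allowed because the
  roots \<open>l\<close> may be complex.\<close>

definition decaying :: "real^'n^'n \<Rightarrow> complex^'n \<Rightarrow> bool" where
  "decaying B v \<longleftrightarrow>
     (\<exists>C w. w > 0 \<and> (\<forall>t\<ge>0. norm (cmat (mat_exp (t *\<^sub>R B)) *v v) \<le> C * exp (- w * t)))"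

text \<open>Variation of constants: \<open>g t = exp (- t l) exp (t B) v\<close> has derivative
  \<open>exp (- t l) exp (t B) w\<close> with \<open>w = B v - l v\<close>, so decay along
  \<open>w\<close> integrates to decay along \<open>v\<close>.\<close>

lemma decaying_step:
  fixes B :: "real^'n^'n"
  assumes l: "Re l < 0" and dec: "decaying B (cmat B *v v - l *s v)"
  shows "decaying B v"
proof -
  define E where "E t = mat_exp (t *\<^sub>R B)" for t
  define w where "w = cmat B *v v - l *s v"
  obtain C r where r: "r > 0" and C: "\<And>t. t \<ge> 0 \<Longrightarrow> norm (cmat (E t) *v w) \<le> C * exp (- r * t)"
    using dec by (auto simp: decaying_def E_def w_def)
  \<comment> \<open>The rate is lowered below \<open>- Re l\<close>, so that \<open>m > 0\<close>
    and integrating \<open>exp (m s)\<close> gives a pure exponential. This avoids the factor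
    \<open>t\<close> that appears in the resonant case \<open>r = - Re l\<close>.\<close>
  define r' where "r' = min r (- Re l / 2)"
  define m where "m = - Re l - r'"
  have r': "r' > 0" "r' \<le> r" and m: "m > 0" using r l by (auto simp: r'_def m_def)
  have "0 \<le> norm (cmat (E 0) *v w)" by simp
  also have "\<dots> \<le> C" using C[of 0] by simp
  finally have C0: "C \<ge> 0" .
  define g where "g t = exp (- (of_real t * l)) *s (cmat (E t) *v v)" for t :: real
  have g': "(g has_vector_derivative exp (- (of_real t * l)) *s (cmat (E t) *v w)) (at t)" for t
  proof -
    have "((\<lambda>t. cmat (E t) *v v) has_vector_derivative cmat (B ** E t) *v v) (at t)"
      unfolding E_def
      by (rule bounded_linear.has_vector_derivative[OF bounded_linear_cmat_vector has_vector_derivative_mat_exp])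
    moreover have "((\<lambda>t. exp (- (of_real t * l))) has_vector_derivative (- l * exp (- (of_real t * l)))) (at t)"
      by (rule has_vector_derivative_real_field) (auto intro!: derivative_eq_intros)
    ultimately have "(g has_vector_derivative
        (exp (- (of_real t * l)) *s (cmat (B ** E t) *v v) + (- l * exp (- (of_real t * l))) *s (cmat (E t) *v v))) (at t)"
      unfolding g_def by (intro bounded_bilinear.has_vector_derivative[OF bounded_bilinear_vector_smult])
    moreover have "B ** E t = E t ** B" unfolding E_def by (rule mat_exp_commute)
    ultimately show ?thesis
      by (simp add: w_def cmat_mult matrix_vector_mul_assoc[symmetric] matrix_vector_mult_diff_distrib
          vector_scalar_commute vec.scale_right_diff_distrib mult.commute)
  qed
  have gb: "norm (g t - g 0) \<le> C / m * exp (m * t)" if t: "t > 0" for t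
  proof -
    have "norm (g t - g 0) \<le> C / m * exp (m * t) - C / m * exp (m * 0)"
    proof (rule differentiable_bound_general[OF t _ _ g'])
      show "continuous_on {0..t} g"
        using g' by (intro continuous_at_imp_continuous_on) (auto intro: has_vector_derivative_continuous)
      show "continuous_on {0..t} (\<lambda>t. C / m * exp (m * t))"
        by (intro continuous_intros)
      show "((\<lambda>t. C / m * exp (m * t)) has_vector_derivative C * exp (m * s)) (at s)" for s
        using m by (auto simp: has_real_derivative_iff_has_vector_derivative[symmetric] intro!: derivative_eq_intros)
      fix s assume s: "0 < s" "s < t"
      have "norm (exp (- (of_real s * l)) *s (cmat (E s) *v w)) = exp (- (s * Re l)) * norm (cmat (E s) *v w)"
        by (simp add: norm_vector_smult norm_exp_eq_Re)
      also have "\<dots> \<le> exp (- (s * Re l)) * (C * exp (- r * s))"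
        using C[of s] s by (intro mult_left_mono) auto
      also have "\<dots> \<le> exp (- (s * Re l)) * (C * exp (- r' * s))"
        using C0 r' s by (intro mult_left_mono) auto
      also have "\<dots> = C * exp (m * s)"
        by (simp add: m_def algebra_simps flip: exp_add)
      finally show "norm (exp (- (of_real s * l)) *s (cmat (E s) *v w)) \<le> C * exp (m * s)" .
    qed
    also have "\<dots> \<le> C / m * exp (m * t)" using C0 m by simp
    finally show ?thesis .
  qed
  have "norm (cmat (E t) *v v) \<le> (norm v + C / m) * exp (- r' * t)" if t: "t \<ge> 0" for t
  proof -
    have "norm (g t - g 0) \<le> C / m * exp (m * t)"
      using gb[of t] t C0 m by (cases "t = 0") auto
    moreover have "norm (g 0) = norm v" by (simp add: g_def E_def)
    ultimately have "norm (g t) \<le> norm v + C / m * exp (m * t)"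
      using norm_triangle_sub[of "g t" "g 0"] by linarith
    also have "\<dots> \<le> (norm v + C / m) * exp (m * t)"
      using m t by (simp add: distrib_right mult_le_cancel_left1)
    finally have *: "norm (g t) \<le> (norm v + C / m) * exp (m * t)" .
    have "norm (g t) = exp (- (t * Re l)) * norm (cmat (E t) *v v)"
      by (simp add: g_def norm_vector_smult norm_exp_eq_Re)
    then have "norm (cmat (E t) *v v) = exp (t * Re l) * norm (g t)"
      by (simp add: exp_minus)
    also have "\<dots> \<le> exp (t * Re l) * ((norm v + C / m) * exp (m * t))"
      using * by (intro mult_left_mono) auto
    also have "\<dots> = (norm v + C / m) * exp (- r' * t)"
      by (simp add: m_def algebra_simps flip: exp_add)
    finally show ?thesis .
  qed
  with r' show ?thesis by (auto simp: decaying_def E_def)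
qed

text \<open>Induction on the degree, splitting off a complex root \<open>l\<close> of
  \<open>p = (z - l) q\<close>. If \<open>l\<close> is an eigenvalue, then \<open>Re l < 0\<close>,
  and the induction hypothesis for \<open>B v - l v\<close> combines with
  \<open>decaying_step\<close>. Otherwise \<open>B - l\<close> is injective, hence already
  \<open>q(B) v = 0\<close>, and the induction hypothesis applies to \<open>v\<close>
  itself.\<close>

lemma decaying_if_annihilated:
  fixes B :: "real^'n^'n"
  assumes B: "\<And>z. eigenvalue_of B z \<Longrightarrow> Re z < 0"
    and "p \<noteq> 0" "degree p \<le> d" "(\<Sum>i\<le>d. coeff p i *s (((*v) (cmat B)) ^^ i) v) = 0"
  shows "decaying B v"
  using assms(2-)
proof (induction d arbitrary: p v)
  case 0
  then have "v = 0" by (auto elim!: degree_eq_zeroE)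
  then show ?case by (auto simp: decaying_def intro!: exI[of _ 1])
next
  case (Suc d)
  show ?case
  proof (cases "degree p \<le> d")
    case True
    then show ?thesis using Suc.prems by (intro Suc.IH[of p]) (auto simp: coeff_eq_0)
  next
    case False
    then have "\<not> constant (poly p)" by (simp add: constant_degree)
    then obtain l where "poly p l = 0" using fundamental_theorem_of_algebra by blast
    then obtain q where q: "p = [:- l, 1:] * q" by (auto simp: poly_eq_0_iff_dvd dvd_def)
    have q0: "q \<noteq> 0" using Suc.prems q by auto
    then have "degree p = Suc (degree q)" unfolding q by (subst degree_mult_eq) auto
    then have dq: "degree q \<le> d" using Suc.prems by simp
    let ?P = "\<lambda>i. ((*v) (cmat B)) ^^ i"
    let ?w = "cmat B *v v - l *s v"
    have w0: "(\<Sum>i\<le>d. coeff q i *s ?P i ?w) = 0"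
      using Suc.prems(3) unfolding q by (subst (asm) poly_apply_linear_factor[OF dq])
    show ?thesis
    proof (cases "eigenvalue_of B l")
      case True
      then show ?thesis by (intro decaying_step[OF B Suc.IH[OF q0 dq w0]])
    next
      case False
      let ?y = "\<Sum>i\<le>d. coeff q i *s ?P i v"
      have "cmat B *v ?y = (\<Sum>i\<le>d. coeff q i *s ?P i (cmat B *v v))"
        by (simp add: vec.linear_sum[OF matrix_vector_mul_linear_gen] vector_scalar_commute funpow_swap1)
      moreover have "l *s ?y = (\<Sum>i\<le>d. coeff q i *s (l *s ?P i v))"
        by (simp add: vec.scale_sum_right mult.commute)
      ultimately have "cmat B *v ?y - l *s ?y = (\<Sum>i\<le>d. coeff q i *s ?P i ?w)"
        by (simp add: funpow_linear sum_subtractf vec.scale_right_diff_distrib)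
      with w0 have "cmat B *v ?y = l *s ?y" by simp
      with False have "?y = 0" unfolding eigenvalue_of_def cmat_def by auto
      then show ?thesis using Suc.IH[OF q0 dq] by auto
    qed
  qed
qed

text \<open>The \<open>n + 1\<close> vectors \<open>v, B v, ..., B^n v\<close> are linearly
  dependent, and the relation is a nonzero polynomial annihilating \<open>v\<close>.\<close>

lemma decaying_all:
  fixes B :: "real^'n^'n"
  assumes B: "\<And>z. eigenvalue_of B z \<Longrightarrow> Re z < 0"
  shows "decaying B v"
proof -
  obtain c where c: "\<exists>i\<le>CARD('n). c i \<noteq> 0" "(\<Sum>i\<le>CARD('n). c i *s (((*v) (cmat B)) ^^ i) v) = 0"
    using vector_sequence_dependent[of "\<lambda>i. (((*v) (cmat B)) ^^ i) v"] by metis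
  define p where "p = (\<Sum>i\<le>CARD('n). monom (c i) i)"
  have p: "coeff p i = (if i \<le> CARD('n) then c i else 0)" for i
    by (simp add: p_def coeff_sum)
  show ?thesis
  proof (rule decaying_if_annihilated[OF B])
    show "p \<noteq> 0" using c(1) p by (metis coeff_0)
    show "degree p \<le> CARD('n)" by (rule degree_le) (simp add: p)
  qed (use c(2) p in auto)
qed

lemma mat_exp_decay:
  fixes B :: "real^'n^'n"
  assumes B: "\<And>z. eigenvalue_of B z \<Longrightarrow> Re z < 0"
  obtains C w where "w > 0" "\<And>t. t \<ge> 0 \<Longrightarrow> norm (mat_exp (t *\<^sub>R B)) \<le> C * exp (- w * t)"
proof -
  define E where "E t = mat_exp (t *\<^sub>R B)" for t
  have "\<forall>j. \<exists>C w. w > 0 \<and> (\<forall>t\<ge>0. norm (cmat (E t) *v axis j 1) \<le> C * exp (- w * t))"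
    using decaying_all[OF B] unfolding decaying_def E_def by blast
  then obtain C w where w: "\<And>j. w j > 0"
    and C: "\<And>j t. t \<ge> 0 \<Longrightarrow> norm (cmat (E t) *v axis j 1) \<le> C j * exp (- w j * t)"
    by metis
  \<comment> \<open>The slowest of the finitely many rates of the columns serves for the whole
    matrix.\<close>
  define W where "W = Min (range w)"
  have W: "W > 0" "\<And>j. W \<le> w j" using w by (auto simp: W_def)
  have C0: "C j \<ge> 0" for j using order_trans[OF norm_ge_zero C[of 0 j]] by simp
  have "norm (E t) \<le> (\<Sum>(i::'n)\<in>UNIV. \<Sum>j\<in>UNIV. C j) * exp (- W * t)" if t: "t \<ge> 0" for t
  proof -
    have e: "\<bar>E t $ i $ j\<bar> \<le> C j * exp (- W * t)" for i j
    proof -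
      have "\<bar>E t $ i $ j\<bar> = norm ((cmat (E t) *v axis j 1) $ i)"
        by (simp add: cmat_def matrix_vector_mult_def axis_def if_distrib cong: if_cong)
      also have "\<dots> \<le> norm (cmat (E t) *v axis j 1)" by (rule Finite_Cartesian_Product.norm_nth_le)
      also have "\<dots> \<le> C j * exp (- w j * t)" by (rule C[OF t])
      also have "\<dots> \<le> C j * exp (- W * t)"
        using C0 W t by (intro mult_left_mono) (auto simp: mult_right_mono)
      finally show ?thesis .
    qed
    have "norm (E t) \<le> (\<Sum>i\<in>UNIV. norm (E t $ i))" by (simp add: norm_vec_def L2_set_le_sum)
    also have "\<dots> \<le> (\<Sum>i\<in>UNIV. \<Sum>j\<in>UNIV. \<bar>E t $ i $ j\<bar>)" by (intro sum_mono norm_le_l1_cart)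
    also have "\<dots> \<le> (\<Sum>(i::'n)\<in>UNIV. \<Sum>j\<in>UNIV. C j * exp (- W * t))" by (intro sum_mono e)
    finally show ?thesis by (simp add: sum_distrib_right mult.assoc)
  qed
  with W(1) show ?thesis using that by (auto simp: E_def)
qed

section \<open>Covariance matrices\<close>

lemma inner_matrix_transpose: "((A :: real^'n^'m) *v x) \<bullet> y = x \<bullet> (transpose A *v y)"
  by (metis dot_lmul_matrix vector_transpose_matrix transpose_transpose)

lemma sym_pos_def_lower_bound:
  fixes A :: "real^'n^'n"
  assumes "sym_pos_def A"
  obtains c where "c > 0" "\<And>x. c * (norm x)\<^sup>2 \<le> (A *v x) \<bullet> x"
proof -
  \<comment> \<open>The constant is the minimum of the Rayleigh quotient, attained by compactness of
    the unit sphere and extended by homogeneity.\<close>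
  have "\<exists>x\<in>sphere 0 1. \<forall>y\<in>sphere 0 1. (A *v x) \<bullet> x \<le> (A *v y) \<bullet> (y :: real^'n)"
    by (intro continuous_attains_inf continuous_intros
        bounded_bilinear.continuous_on[OF bounded_bilinear_matrix_vector_mult]) auto
  then obtain u where u: "norm u = 1" "\<And>y. norm y = 1 \<Longrightarrow> (A *v u) \<bullet> u \<le> (A *v y) \<bullet> y" by auto
  show ?thesis
  proof (rule that[of "(A *v u) \<bullet> u"])
    have "u \<noteq> 0" using u(1) by auto
    then show "(A *v u) \<bullet> u > 0" using assms by (simp add: sym_pos_def_def)
    fix x :: "real^'n"
    show "(A *v u) \<bullet> u * (norm x)\<^sup>2 \<le> (A *v x) \<bullet> x"
    proof (cases "x = 0")
      case False
      have "(A *v u) \<bullet> u \<le> (A *v (x /\<^sub>R norm x)) \<bullet> (x /\<^sub>R norm x)"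
        using False by (intro u(2)) simp
      also have "\<dots> = ((A *v x) \<bullet> x) / (norm x)\<^sup>2"
        by (simp add: matrix_vector_mult_scaleR power2_eq_square divide_inverse mult_ac)
      finally show ?thesis using False by (simp add: field_simps)
    qed simp
  qed
qed

lemma matrix_vector_norm_bound:
  obtains K where "K > 0" "\<And>(A::real^'m^'n) x. norm (A *v x) \<le> K * norm A * norm x"
proof -
  obtain K where "K > 0" "\<And>(A::real^'m^'n) x. norm (A *v x) \<le> norm A * norm x * K"
    using bounded_bilinear.pos_bounded[OF bounded_bilinear_matrix_vector_mult] by blast
  then show ?thesis by (intro that[of K]) (auto simp: mult_ac)
qed

lemma matrix_quadratic_upper_bound:
  obtains K where "K > 0" "\<And>(A::real^'n^'n) x. (A *v x) \<bullet> x \<le> K * norm A * (norm x)\<^sup>2"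
proof -
  obtain K where K: "K > 0" "\<And>(A::real^'n^'n) x. norm (A *v x) \<le> K * norm A * norm x"
    using matrix_vector_norm_bound by metis
  have "(A *v x) \<bullet> x \<le> K * norm A * (norm x)\<^sup>2" for A :: "real^'n^'n" and x
  proof -
    have "(A *v x) \<bullet> x \<le> norm (A *v x) * norm x" by (rule norm_cauchy_schwarz)
    also have "\<dots> \<le> K * norm A * norm x * norm x" by (intro mult_right_mono K) auto
    finally show ?thesis by (simp add: power2_eq_square mult.assoc)
  qed
  with K(1) that show ?thesis by blast
qed

section \<open>Covariance integrals: two-sided bounds and the splitting at time
  \<open>t\<close>\<close>

locale ou_data =
  fixes Q B :: "real^'n^'n"
  assumes spd: "sym_pos_def Q"
    and stable: "\<And>z. eigenvalue_of B z \<Longrightarrow> Re z < 0"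
begin

abbreviation M :: "real \<Rightarrow> real^'n^'n" where "M t \<equiv> mat_exp (t *\<^sub>R B)"
abbreviation P :: "real \<Rightarrow> real^'n^'n" where "P t \<equiv> ou_cov Q B (ereal t)"
abbreviation S :: "real^'n^'n" where "S \<equiv> ou_cov Q B \<infinity>"

definition integrand :: "real \<Rightarrow> real^'n^'n" where
  "integrand s = M s ** Q ** transpose (M s)"

lemma P_eq: "P t = integral {0..t} integrand"
  and S_eq: "S = integral {0..} integrand"
proof -
  have "(\<lambda>s. mat_exp (s *\<^sub>R B) ** Q ** mat_exp (s *\<^sub>R transpose B)) = integrand"
    by (simp add: fun_eq_iff integrand_def mat_exp_transpose transpose_scalar)
  moreover have "{s. 0 \<le> s \<and> ereal s \<le> ereal t} = {0..t}" "{s. 0 \<le> s \<and> ereal s \<le> \<infinity>} = {0..}"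
    by auto
  ultimately show "P t = integral {0..t} integrand" "S = integral {0..} integrand"
    by (simp_all add: ou_cov_def)
qed

lemma continuous_on_M: "continuous_on A M"
  by (rule continuous_on_mat_exp)

lemma continuous_on_transpose_M: "continuous_on A (\<lambda>s. transpose (M s))"
  by (rule bounded_linear.continuous_on[OF bounded_linear_transpose continuous_on_M])

lemma continuous_on_integrand: "continuous_on A integrand"
  unfolding integrand_def
  by (intro bounded_bilinear.continuous_on[OF bounded_bilinear_matrix_mult] continuous_on_M
      continuous_on_transpose_M continuous_on_const)

lemma M_bounded: obtains C where "C > 0" "\<And>t. t \<ge> 0 \<Longrightarrow> norm (M t) \<le> C"
proof -
  obtain C w where C: "w > 0" "\<And>t. t \<ge> 0 \<Longrightarrow> norm (M t) \<le> C * exp (- w * t)"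
    using mat_exp_decay[OF stable] by blast
  have "0 \<le> C" using order_trans[OF norm_ge_zero C(2)[of 0]] by simp
  have "norm (M t) \<le> C + 1" if "t \<ge> 0" for t
  proof -
    have "C * exp (- w * t) \<le> C * 1" using C(1) that \<open>0 \<le> C\<close> by (intro mult_left_mono) auto
    with C(2)[OF that] show ?thesis by simp
  qed
  with \<open>0 \<le> C\<close> show ?thesis by (intro that[of "C + 1"]) auto
qed

lemma integrand_bound:
  obtains C w where "w > 0" "\<And>s. s \<ge> 0 \<Longrightarrow> norm (integrand s) \<le> C * exp (- w * s)"
proof -
  obtain C w where w: "w > 0" and C: "\<And>t. t \<ge> 0 \<Longrightarrow> norm (M t) \<le> C * exp (- w * t)"
    using mat_exp_decay[OF stable] by blast
  obtain K where K: "K > 0" "\<And>(A::real^'n^'n) (B::real^'n^'n). norm (A ** B) \<le> norm A * norm B * K"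
    using bounded_bilinear.pos_bounded[OF bounded_bilinear_matrix_mult] by blast
  obtain T where T: "T > 0" "\<And>A::real^'n^'n. norm (transpose A) \<le> norm A * T"
    using bounded_linear.pos_bounded[OF bounded_linear_transpose] by blast
  have C0: "0 \<le> C" using order_trans[OF norm_ge_zero C[of 0]] by simp
  have "norm (integrand s) \<le> (C * norm Q * K * (C * T) * K) * exp (- (2 * w) * s)" if s: "s \<ge> 0" for s
  proof -
    have "norm (integrand s) \<le> norm (M s ** Q) * norm (transpose (M s)) * K"
      unfolding integrand_def by (rule K)
    also have "\<dots> \<le> (norm (M s) * norm Q * K) * (norm (M s) * T) * K"
      using K T by (intro mult_right_mono mult_mono) auto
    also have "\<dots> \<le> (C * exp (- w * s) * norm Q * K) * (C * exp (- w * s) * T) * K"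
      using K(1) T(1) C[OF s] C0 by (intro mult_right_mono mult_mono) auto
    also have "\<dots> = (C * norm Q * K * (C * T) * K) * exp (- (2 * w) * s)"
      by (simp add: algebra_simps flip: exp_add)
    finally show ?thesis .
  qed
  with w show ?thesis by (intro that[of "2 * w"]) auto
qed

lemma integrable_integrand: "integrand integrable_on {0..t}" "integrand integrable_on {0..}"
proof -
  obtain C w where C: "w > 0" "\<And>s. s \<ge> 0 \<Longrightarrow> norm (integrand s) \<le> C * exp (- w * s)"
    using integrand_bound by blast
  show "integrand integrable_on {0..}"
  proof (rule measurable_bounded_by_integrable_imp_integrable)
    show "integrand \<in> borel_measurable (lebesgue_on {0..})"
      by (intro continuous_imp_measurable_on_sets_lebesgue continuous_on_integrand) auto
    show "(\<lambda>s. C * exp (- w * s)) integrable_on {0..}"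
      using integrable_on_exp_minus_to_infinity[OF C(1), of 0] by (intro integrable_on_mult_right)
  qed (use C in auto)
  show "integrand integrable_on {0..t}"
    by (intro integrable_continuous_interval continuous_on_integrand)
qed

lemma integral_integrand_inner:
  assumes "integrand integrable_on A"
  shows "(integral A integrand *v x) \<bullet> y = integral A (\<lambda>s. (integrand s *v x) \<bullet> y)"
    and "(\<lambda>s. (integrand s *v x) \<bullet> y) integrable_on A"
proof -
  have bl: "bounded_linear (\<lambda>A::real^'n^'n. (A *v x) \<bullet> y)"
    by (intro bounded_linear_inner_left_comp bounded_bilinear.bounded_linear_left[OF bounded_bilinear_matrix_vector_mult])
  show "(integral A integrand *v x) \<bullet> y = integral A (\<lambda>s. (integrand s *v x) \<bullet> y)"
    using integral_linear[OF assms bl] by (simp add: o_def)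
  show "(\<lambda>s. (integrand s *v x) \<bullet> y) integrable_on A"
    using integrable_linear[OF assms bl] by (simp add: o_def)
qed

lemma integrand_quadratic: "(integrand s *v x) \<bullet> x = (Q *v (transpose (M s) *v x)) \<bullet> (transpose (M s) *v x)"
  unfolding integrand_def matrix_vector_mul_assoc[symmetric] by (rule inner_matrix_transpose)

lemma integrand_nonneg: "0 \<le> (integrand s *v x) \<bullet> x"
proof -
  have "0 \<le> (Q *v y) \<bullet> y" for y
    using spd by (cases "y = 0") (simp_all add: sym_pos_def_def less_imp_le)
  then show ?thesis unfolding integrand_quadratic .
qed

lemma integrand_symmetric: "transpose (integrand s) = integrand s"
proof -
  have "transpose Q = Q" using spd by (simp add: sym_pos_def_def)
  then show ?thesis by (simp add: integrand_def matrix_transpose_mul matrix_mul_assoc)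
qed

lemma cov_symmetric: "transpose (P t) = P t" "transpose S = S"
proof -
  have *: "transpose (integral A integrand) = integral A integrand" if "integrand integrable_on A" for A
  proof -
    have "transpose \<circ> integrand = integrand" by (simp add: fun_eq_iff integrand_symmetric)
    then show ?thesis using integral_linear[OF that bounded_linear_transpose] by metis
  qed
  show "transpose (P t) = P t" "transpose S = S"
    unfolding P_eq S_eq by (rule *[OF integrable_integrand(1)], rule *[OF integrable_integrand(2)])
qed

text \<open>\<open>M s\<close> has the inverse \<open>M (- s)\<close>, bounded for \<open>s\<close>
  in [0, 1], so \<open>transpose (M s)\<close> shrinks vectors by at most a fixed factor, and the
  positivity of \<open>Q\<close> survives uniformly.\<close>

lemma integrand_lower_bound:
  obtains c where "c > 0" "\<And>s x. 0 \<le> s \<Longrightarrow> s \<le> 1 \<Longrightarrow> c * (norm x)\<^sup>2 \<le> (integrand s *v x) \<bullet> x"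
proof -
  obtain q where q: "q > 0" "\<And>x. q * (norm x)\<^sup>2 \<le> (Q *v x) \<bullet> x"
    using sym_pos_def_lower_bound[OF spd] by blast
  obtain K where K: "K > 0" "\<And>(A::real^'n^'n) x. norm (A *v x) \<le> K * norm A * norm x"
    using matrix_vector_norm_bound by metis
  have "continuous_on {0..1} (\<lambda>s. transpose (M (- s)))"
    using bounded_linear.continuous_on[OF bounded_linear_transpose continuous_on_mat_exp[of "{0..1}" "- B"]]
    by simp
  then have "bounded ((\<lambda>s. transpose (M (- s))) ` {0..1})"
    by (intro compact_imp_bounded compact_continuous_image) auto
  then obtain L where L: "L > 0" "\<And>s. 0 \<le> s \<Longrightarrow> s \<le> 1 \<Longrightarrow> norm (transpose (M (- s))) \<le> L"
    unfolding bounded_pos by auto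
  have "q / (K * L)\<^sup>2 * (norm x)\<^sup>2 \<le> (integrand s *v x) \<bullet> x" if s: "0 \<le> s" "s \<le> 1" for s x
  proof -
    let ?y = "transpose (M s) *v x"
    have "M s ** M (- s) = mat 1" using mat_exp_add[of s "- s" B] by simp
    then have "transpose (M (- s)) ** transpose (M s) = mat 1"
      by (simp add: matrix_transpose_mul[symmetric])
    then have "x = transpose (M (- s)) *v ?y"
      by (metis matrix_vector_mul_assoc matrix_vector_mul_lid)
    then have "norm x \<le> K * norm (transpose (M (- s))) * norm ?y"
      using K(2)[of "transpose (M (- s))" ?y] by metis
    also have "\<dots> \<le> K * L * norm ?y"
      using K(1) L(2)[OF s] by (intro mult_right_mono mult_left_mono) auto
    finally have "(norm x)\<^sup>2 \<le> (K * L * norm ?y)\<^sup>2" by (intro power_mono) auto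
    then have "q / (K * L)\<^sup>2 * (norm x)\<^sup>2 \<le> q / (K * L)\<^sup>2 * (K * L * norm ?y)\<^sup>2"
      using q by (intro mult_left_mono) auto
    also have "\<dots> = q * (norm ?y)\<^sup>2" using K L by (simp add: power_mult_distrib)
    also have "\<dots> \<le> (integrand s *v x) \<bullet> x" unfolding integrand_quadratic by (rule q)
    finally show ?thesis .
  qed
  then show ?thesis using q K L by (intro that[of "q / (K * L)\<^sup>2"]) auto
qed

lemma P_le_S: "(P t *v x) \<bullet> x \<le> (S *v x) \<bullet> x"
proof -
  have "integral {0..t} (\<lambda>s. (integrand s *v x) \<bullet> x) \<le> integral {0..} (\<lambda>s. (integrand s *v x) \<bullet> x)"
    by (intro integral_subset_le integral_integrand_inner(2) integrable_integrand)
      (auto simp: integrand_nonneg)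
  then show ?thesis
    by (simp add: P_eq S_eq integral_integrand_inner(1) integrable_integrand)
qed

lemma P_mono: "s \<le> t \<Longrightarrow> (P s *v x) \<bullet> x \<le> (P t *v x) \<bullet> x"
proof -
  assume "s \<le> t"
  then have "integral {0..s} (\<lambda>s. (integrand s *v x) \<bullet> x) \<le> integral {0..t} (\<lambda>s. (integrand s *v x) \<bullet> x)"
    by (intro integral_subset_le integral_integrand_inner(2) integrable_integrand)
      (auto simp: integrand_nonneg)
  then show ?thesis
    by (simp add: P_eq integral_integrand_inner(1) integrable_integrand)
qed

text \<open>For \<open>t \<le> 1\<close> the bounds of the integrand are integrated over an interval
  of length \<open>t\<close>. For \<open>t > 1\<close> monotonicity places the form of
  \<open>P t\<close> between those of \<open>P 1\<close> and \<open>S\<close>. Hence the factor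
  \<open>min 1 t\<close>.\<close>

lemma cov_bounds:
  obtains c C where "c > 0" "C > 0"
    "\<And>t x. t > 0 \<Longrightarrow> c * min 1 t * (norm x)\<^sup>2 \<le> (P t *v x) \<bullet> x"
    "\<And>t x. t > 0 \<Longrightarrow> (P t *v x) \<bullet> x \<le> C * min 1 t * (norm x)\<^sup>2"
    "\<And>x. c * (norm x)\<^sup>2 \<le> (S *v x) \<bullet> x"
    "\<And>x. (S *v x) \<bullet> x \<le> C * (norm x)\<^sup>2"
proof -
  obtain c where c: "c > 0" "\<And>s x. 0 \<le> s \<Longrightarrow> s \<le> 1 \<Longrightarrow> c * (norm x)\<^sup>2 \<le> (integrand s *v x) \<bullet> x"
    using integrand_lower_bound by blast
  obtain K where K: "K > 0" "\<And>(A::real^'n^'n) x. (A *v x) \<bullet> x \<le> K * norm A * (norm x)\<^sup>2"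
    using matrix_quadratic_upper_bound by metis
  obtain N where N: "N > 0" "\<And>s. 0 \<le> s \<Longrightarrow> s \<le> 1 \<Longrightarrow> norm (integrand s) \<le> N"
  proof -
    have "bounded (integrand ` {0..1})"
      by (intro compact_imp_bounded compact_continuous_image continuous_on_integrand) auto
    then show ?thesis using that unfolding bounded_pos by auto
  qed
  define C where "C = max (K * N) (K * norm S)"
  have lo: "c * t * (norm x)\<^sup>2 \<le> (P t *v x) \<bullet> x" if t: "0 < t" "t \<le> 1" for t x
  proof -
    have "integral {0..t} (\<lambda>s. c * (norm x)\<^sup>2) \<le> integral {0..t} (\<lambda>s. (integrand s *v x) \<bullet> x)"
      using t by (intro integral_le integral_integrand_inner integrable_integrand c) auto
    then show ?thesis using t
      unfolding P_eq integral_integrand_inner(1)[OF integrable_integrand(1)] by (simp add: mult_ac)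
  qed
  have up: "(P t *v x) \<bullet> x \<le> C * t * (norm x)\<^sup>2" if t: "0 < t" "t \<le> 1" for t x
  proof -
    have "(integrand s *v x) \<bullet> x \<le> C * (norm x)\<^sup>2" if "s \<in> {0..t}" for s
    proof -
      have "(integrand s *v x) \<bullet> x \<le> K * norm (integrand s) * (norm x)\<^sup>2" by (rule K)
      also have "\<dots> \<le> K * N * (norm x)\<^sup>2"
        using K(1) N(2)[of s] that t by (intro mult_right_mono mult_left_mono) auto
      also have "\<dots> \<le> C * (norm x)\<^sup>2" by (intro mult_right_mono) (auto simp: C_def)
      finally show ?thesis .
    qed
    then have "integral {0..t} (\<lambda>s. (integrand s *v x) \<bullet> x) \<le> integral {0..t} (\<lambda>s. C * (norm x)\<^sup>2)"
      by (intro integral_le integral_integrand_inner integrable_integrand) auto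
    then show ?thesis using t
      unfolding P_eq integral_integrand_inner(1)[OF integrable_integrand(1)] by (simp add: mult_ac)
  qed
  have upS: "(S *v x) \<bullet> x \<le> C * (norm x)\<^sup>2" for x
  proof -
    have "(S *v x) \<bullet> x \<le> K * norm S * (norm x)\<^sup>2" by (rule K)
    also have "\<dots> \<le> C * (norm x)\<^sup>2" by (intro mult_right_mono) (auto simp: C_def)
    finally show ?thesis .
  qed
  show ?thesis
  proof (rule that[of c C])
    show "C > 0" using K N by (simp add: C_def less_max_iff_disj)
    show "c * min 1 t * (norm x)\<^sup>2 \<le> (P t *v x) \<bullet> x" if "t > 0" for t x
      using lo[of t x] lo[of 1 x] P_mono[of 1 t x] that by (cases "t \<le> 1") (auto simp: min_def)
    show "(P t *v x) \<bullet> x \<le> C * min 1 t * (norm x)\<^sup>2" if "t > 0" for t x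
      using up[of t x] upS[of x] P_le_S[of t x] that by (cases "t \<le> 1") (auto simp: min_def)
    show "c * (norm x)\<^sup>2 \<le> (S *v x) \<bullet> x" for x
      using lo[of 1 x] P_le_S[of 1 x] by simp
  qed (use c upS in auto)
qed

lemma integrand_add: "integrand (s + t) = M t ** integrand s ** transpose (M t)"
proof -
  have "M (s + t) = M t ** M s" using mat_exp_add[of t s B] by (simp add: add.commute)
  then show ?thesis by (simp add: integrand_def matrix_transpose_mul matrix_mul_assoc)
qed

lemma P_tendsto_S:
  assumes "filterlim a at_top sequentially"
  shows "(\<lambda>k. P (a k)) \<longlonglongrightarrow> S"
proof -
  obtain C w where C: "w > 0" "\<And>s. s \<ge> 0 \<Longrightarrow> norm (integrand s) \<le> C * exp (- w * s)"
    using integrand_bound by blast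
  let ?f = "\<lambda>k s. if s \<in> {0..a k} then integrand s else 0"
  have sub: "{0..} \<inter> {0..a k} = {0..a k}" for k by auto
  have "(\<lambda>k. integral {0..} (?f k)) \<longlonglongrightarrow> integral {0..} integrand"
  proof (rule dominated_convergence(2))
    show "?f k integrable_on {0..}" for k
      by (subst integrable_restrict_Int) (simp add: sub integrable_integrand)
    show "(\<lambda>s. C * exp (- w * s)) integrable_on {0..}"
      using integrable_on_exp_minus_to_infinity[OF C(1), of 0] by (intro integrable_on_mult_right)
    show "norm (?f k s) \<le> C * exp (- w * s)" if "s \<in> {0..}" for k s
      using C(2)[of s] order_trans[OF norm_ge_zero C(2)[of s]] that by auto
    show "(\<lambda>k. ?f k s) \<longlonglongrightarrow> integrand s" if "s \<in> {0..}" for s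
    proof (rule tendsto_eventually)
      have "\<forall>\<^sub>F k in sequentially. s \<le> a k" using assms by (simp add: filterlim_at_top)
      then show "\<forall>\<^sub>F k in sequentially. ?f k s = integrand s"
        by eventually_elim (use that in auto)
    qed
  qed
  moreover have "integral {0..} (?f k) = P (a k)" for k
    by (subst integral_restrict_Int) (simp add: sub P_eq)
  ultimately show ?thesis by (simp add: S_eq)
qed

text \<open>Shifting time by \<open>t\<close> conjugates the integrand by \<open>M t\<close>. The
  shift is made on the compact interval from \<open>t\<close> to \<open>t + k\<close> and then
  \<open>k\<close> tends to infinity. In probabilistic terms this is the invariance of the Gaussian
  with covariance \<open>S\<close>.\<close>

lemma cov_split:
  assumes "t > 0"
  shows "S = P t + M t ** S ** transpose (M t)"
proof -
  have "P (t + real k) = P t + M t ** P (real k) ** transpose (M t)" for k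
  proof -
    have bl: "bounded_linear (\<lambda>X::real^'n^'n. M t ** X ** transpose (M t))"
      by (rule bounded_linear_compose[OF bounded_bilinear.bounded_linear_left[OF bounded_bilinear_matrix_mult]
            bounded_bilinear.bounded_linear_right[OF bounded_bilinear_matrix_mult]])
    have "P (t + real k) = integral {0..t} integrand + integral {t..t + real k} integrand"
      unfolding P_eq using assms integrable_integrand
      by (intro Henstock_Kurzweil_Integration.integral_combine[symmetric]) auto
    also have "integral {t..t + real k} integrand = integral {0..real k} (integrand \<circ> (\<lambda>s. s + t))"
      by (subst integral_shift) (auto intro!: continuous_on_integrand simp: add.commute)
    also have "\<dots> = integral {0..real k} ((\<lambda>X. M t ** X ** transpose (M t)) \<circ> integrand)"
      by (simp add: o_def integrand_add)
    also have "\<dots> = M t ** integral {0..real k} integrand ** transpose (M t)"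
      by (rule integral_linear[OF integrable_integrand(1) bl])
    finally show ?thesis by (simp add: P_eq)
  qed
  moreover have "(\<lambda>k. P t + M t ** P (real k) ** transpose (M t)) \<longlonglongrightarrow> P t + M t ** S ** transpose (M t)"
    by (intro tendsto_intros P_tendsto_S[OF filterlim_real_sequentially] bounded_bilinear.tendsto[OF bounded_bilinear_matrix_mult])
  moreover have "(\<lambda>k. P (t + real k)) \<longlonglongrightarrow> S"
    by (intro P_tendsto_S filterlim_tendsto_add_at_top[OF tendsto_const filterlim_real_sequentially])
  ultimately show ?thesis by (simp add: LIMSEQ_unique)
qed

end

section \<open>Bounds for the Mehler kernel\<close>

lemma inner_symmetric_matrix:
  fixes A :: "real^'n^'n"
  assumes "transpose A = A"
  shows "(A *v x) \<bullet> y = (A *v y) \<bullet> x"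
  using inner_matrix_transpose[of A x y] assms by (simp add: inner_commute)

lemma det_entries_bound:
  fixes A :: "real^'n^'n"
  assumes "\<And>i j. \<bar>A $ i $ j\<bar> \<le> m"
  shows "\<bar>det A\<bar> \<le> fact CARD('n) * m ^ CARD('n)"
proof -
  have "\<bar>det A\<bar> \<le> (\<Sum>p | p permutes (UNIV :: 'n set). \<bar>of_int (sign p) * (\<Prod>i\<in>UNIV. A $ i $ p i)\<bar>)"
    unfolding det_def by (rule sum_abs)
  also have "\<dots> \<le> (\<Sum>p | p permutes (UNIV :: 'n set). m ^ CARD('n))"
  proof (rule sum_mono)
    fix p :: "'n \<Rightarrow> 'n"
    have "\<bar>of_int (sign p) * (\<Prod>i\<in>UNIV. A $ i $ p i)\<bar> = (\<Prod>i\<in>UNIV. \<bar>A $ i $ p i\<bar>)"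
      by (simp add: abs_mult abs_prod sign_def)
    also have "\<dots> \<le> (\<Prod>i\<in>(UNIV :: 'n set). m)" by (intro prod_mono) (auto simp: assms)
    finally show "\<bar>of_int (sign p) * (\<Prod>i\<in>UNIV. A $ i $ p i)\<bar> \<le> m ^ CARD('n)" by simp
  qed
  also have "\<dots> = fact CARD('n) * m ^ CARD('n)"
    by (simp add: card_permutations[OF refl])
  finally show ?thesis .
qed

text \<open>The coercivity constant is carried as a parameter because for \<open>P t\<close> it
  degenerates like \<open>min 1 t\<close>, and the bounds for inverse and determinant must record
  that rate.\<close>

locale coercive_matrix =
  fixes A :: "real^'n^'n" and c :: real
  assumes sym: "transpose A = A" and c: "c > 0" and coercive: "\<And>x. c * (norm x)\<^sup>2 \<le> (A *v x) \<bullet> x"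
begin

lemma inv: "A ** matrix_inv A = mat 1" "matrix_inv A ** A = mat 1"
proof -
  have "x = 0" if "A *v x = 0" for x
    using coercive[of x] c that by (simp add: mult_le_0_iff)
  then have "invertible A"
    unfolding invertible_left_inverse matrix_left_invertible_ker by blast
  then have "A ** matrix_inv A = mat 1 \<and> matrix_inv A ** A = mat 1"
    unfolding invertible_def matrix_inv_def by (rule someI_ex)
  then show "A ** matrix_inv A = mat 1" "matrix_inv A ** A = mat 1" by auto
qed

lemma inv_vector: "A *v (matrix_inv A *v x) = x" "matrix_inv A *v (A *v x) = x"
  by (simp_all add: matrix_vector_mul_assoc inv)

lemma inv_symmetric: "(matrix_inv A *v x) \<bullet> y = (matrix_inv A *v y) \<bullet> x"
  using inner_symmetric_matrix[OF sym, of "matrix_inv A *v x" "matrix_inv A *v y"]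
  by (simp add: inv_vector inner_commute)

lemma norm_ge: "c * norm x \<le> norm (A *v x)"
proof (cases "x = 0")
  case False
  have "c * norm x * norm x \<le> (A *v x) \<bullet> x" using coercive[of x] by (simp add: power2_eq_square mult.assoc)
  also have "\<dots> \<le> norm (A *v x) * norm x" by (rule norm_cauchy_schwarz)
  finally show ?thesis using False by simp
qed simp

lemma nonneg: "0 \<le> (A *v x) \<bullet> x"
  using coercive[of x] c by (meson order_trans zero_le_mult_iff zero_le_power2 less_imp_le)

lemma inv_norm_le: "norm (matrix_inv A *v x) \<le> norm x / c"
  using norm_ge[of "matrix_inv A *v x"] c by (simp add: inv_vector field_simps)

lemma inv_upper: "(matrix_inv A *v x) \<bullet> x \<le> (norm x)\<^sup>2 / c"
proof -
  have "(matrix_inv A *v x) \<bullet> x \<le> norm (matrix_inv A *v x) * norm x" by (rule norm_cauchy_schwarz)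
  also have "\<dots> \<le> norm x / c * norm x" by (intro mult_right_mono inv_norm_le) auto
  finally show ?thesis by (simp add: power2_eq_square)
qed

text \<open>The quadratic form of the inverse is the Legendre transform of the quadratic form.\<close>

lemma inv_dual: "2 * (w \<bullet> z) - (A *v w) \<bullet> w \<le> (matrix_inv A *v z) \<bullet> z"
proof -
  let ?y = "matrix_inv A *v z"
  have "0 \<le> (A *v (w - ?y)) \<bullet> (w - ?y)" by (rule nonneg)
  also have "\<dots> = (A *v w) \<bullet> w - (A *v w) \<bullet> ?y - z \<bullet> w + z \<bullet> ?y"
    by (simp add: matrix_vector_mult_diff_distrib inv_vector inner_diff_left inner_diff_right)
  also have "(A *v w) \<bullet> ?y = z \<bullet> w"
    using inner_symmetric_matrix[OF sym, of w ?y] by (simp add: inv_vector)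
  finally show ?thesis by (simp add: inner_commute)
qed

lemma inv_dual_eq: "2 * ((matrix_inv A *v z) \<bullet> z) - (A *v (matrix_inv A *v z)) \<bullet> (matrix_inv A *v z) = (matrix_inv A *v z) \<bullet> z"
  by (simp add: inv_vector inner_commute)

text \<open>The test vector \<open>z / C\<close> in \<open>inv_dual\<close>; it is the optimal one
  when \<open>A\<close> is \<open>C\<close> times the identity.\<close>

lemma inv_lower:
  assumes C: "C > 0" and "\<And>x. (A *v x) \<bullet> x \<le> C * (norm x)\<^sup>2"
  shows "(norm z)\<^sup>2 / C \<le> (matrix_inv A *v z) \<bullet> z"
proof -
  have "(A *v (z /\<^sub>R C)) \<bullet> (z /\<^sub>R C) = (A *v z) \<bullet> z / C\<^sup>2"
    by (simp add: matrix_vector_mult_scaleR power2_eq_square field_simps)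
  also have "\<dots> \<le> C * (norm z)\<^sup>2 / C\<^sup>2" using assms by (intro divide_right_mono) auto
  also have "\<dots> = (norm z)\<^sup>2 / C" using C by (simp add: power2_eq_square)
  finally have "2 * (norm z)\<^sup>2 / C - (norm z)\<^sup>2 / C \<le> 2 * ((z /\<^sub>R C) \<bullet> z) - (A *v (z /\<^sub>R C)) \<bullet> (z /\<^sub>R C)"
    by (simp add: power2_norm_eq_inner divide_inverse mult_ac)
  also have "\<dots> \<le> (matrix_inv A *v z) \<bullet> z" by (rule inv_dual)
  finally show ?thesis by simp
qed

text \<open>The maximiser \<open>matrix_inv A' *v z\<close> of the dual problem for the larger form
  is a competitor in the dual problem for the smaller form, which can only increase the
  supremum.\<close>

lemma inv_antimono:
  assumes "coercive_matrix A' c'" "\<And>x. (A *v x) \<bullet> x \<le> (A' *v x) \<bullet> x"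
  shows "(matrix_inv A' *v z) \<bullet> z \<le> (matrix_inv A *v z) \<bullet> z"
proof -
  interpret A': coercive_matrix A' c' by fact
  let ?w = "matrix_inv A' *v z"
  have "?w \<bullet> z = 2 * (?w \<bullet> z) - (A' *v ?w) \<bullet> ?w" by (rule A'.inv_dual_eq[symmetric])
  also have "\<dots> \<le> 2 * (?w \<bullet> z) - (A *v ?w) \<bullet> ?w" using assms(2)[of ?w] by simp
  also have "\<dots> \<le> (matrix_inv A *v z) \<bullet> z" by (rule inv_dual)
  finally show ?thesis .
qed

text \<open>The library's volume formula for linear images needs a well-ordered index type, so the
  determinant is bounded from below through the entries of the inverse.\<close>

lemma det_lower: "c ^ CARD('n) / fact CARD('n) \<le> \<bar>det A\<bar>"
proof -
  have "norm (matrix_inv A $ i $ j) \<le> 1 / c" for i j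
  proof -
    have "norm (matrix_inv A $ i $ j) = norm ((matrix_inv A *v axis j 1) $ i)"
      by (simp add: matrix_vector_mult_basis column_def)
    also have "\<dots> \<le> norm (matrix_inv A *v axis j 1)" by (rule Finite_Cartesian_Product.norm_nth_le)
    also have "\<dots> \<le> 1 / c" using inv_norm_le[of "axis j 1"] by simp
    finally show ?thesis .
  qed
  then have "\<bar>det (matrix_inv A)\<bar> \<le> fact CARD('n) * (1 / c) ^ CARD('n)" by (intro det_entries_bound) auto
  then have "\<bar>det A\<bar> * \<bar>det (matrix_inv A)\<bar> \<le> \<bar>det A\<bar> * (fact CARD('n) * (1 / c) ^ CARD('n))"
    by (intro mult_left_mono) auto
  moreover have "\<bar>det A\<bar> * \<bar>det (matrix_inv A)\<bar> = 1"
    by (simp add: det_mul[symmetric] inv abs_mult[symmetric])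
  ultimately show ?thesis using c by (simp add: field_simps power_one_over)
qed

end

lemma continuous_on_det:
  fixes f :: "'a::topological_space \<Rightarrow> real^'n^'n"
  assumes "continuous_on T f"
  shows "continuous_on T (\<lambda>t. det (f t))"
  unfolding det_def using assms by (intro continuous_intros)

text \<open>By Cramer's rule the components are quotients of determinants, which are polynomial in
  the entries.\<close>

lemma continuous_on_matrix_inv_vector:
  fixes f :: "'a::topological_space \<Rightarrow> real^'n^'n"
  assumes f: "continuous_on T f" and w: "continuous_on T w"
    and det: "\<And>t. t \<in> T \<Longrightarrow> det (f t) \<noteq> 0"
  shows "continuous_on T (\<lambda>t. matrix_inv (f t) *v w t)"
proof -
  have "continuous_on T (\<lambda>t. \<chi> k. det (\<chi> i j. if j = k then w t $ i else f t $ i $ j) / det (f t))"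
  proof (intro continuous_on_vec_lambda continuous_on_divide continuous_on_det f)
    fix i j k
    show "continuous_on T (\<lambda>t. if j = k then w t $ i else f t $ i $ j)"
      using f w by (cases "j = k") (auto intro!: continuous_intros)
  qed (use det in auto)
  moreover have "matrix_inv (f t) *v w t = (\<chi> k. det (\<chi> i j. if j = k then w t $ i else f t $ i $ j) / det (f t))"
    if "t \<in> T" for t
  proof -
    have "invertible (f t)" using det[OF that] by (simp add: invertible_det_nz)
    then have "f t ** matrix_inv (f t) = mat 1 \<and> matrix_inv (f t) ** f t = mat 1"
      unfolding invertible_def matrix_inv_def by (rule someI_ex)
    then have "f t *v (matrix_inv (f t) *v w t) = w t"
      by (simp add: matrix_vector_mul_assoc)
    then show ?thesis using cramer[OF det[OF that]] by simp
  qed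
  ultimately show ?thesis by (simp cong: continuous_on_cong)
qed

section \<open>The exponents \<open>E\<close> and \<open>F\<close> and the resulting kernel
  bounds\<close>

context ou_data
begin

abbreviation R :: "real^'n \<Rightarrow> real" where "R \<equiv> ou_R Q B"

definition E :: "real \<Rightarrow> real^'n \<Rightarrow> real^'n \<Rightarrow> real" where
  "E t x y = (1/2) * ((matrix_inv (P t) *v (y - M t *v x)) \<bullet> (y - M t *v x))"

definition F :: "real \<Rightarrow> real^'n \<Rightarrow> real^'n \<Rightarrow> real" where
  "F t x y = (1/2) * (((matrix_inv (P t) - matrix_inv S) *v (y - ou_D Q B t *v x)) \<bullet> (y - ou_D Q B t *v x))"

lemma coercive_cov:
  obtains c C where "c > 0" "C > 0" "\<And>t. t > 0 \<Longrightarrow> coercive_matrix (P t) (c * min 1 t)" "coercive_matrix S c"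
    "\<And>t x. t > 0 \<Longrightarrow> (P t *v x) \<bullet> x \<le> C * min 1 t * (norm x)\<^sup>2"
    "\<And>x. (S *v x) \<bullet> x \<le> C * (norm x)\<^sup>2"
proof -
  obtain c C where "c > 0" "C > 0"
    "\<And>t x. t > 0 \<Longrightarrow> c * min 1 t * (norm x)\<^sup>2 \<le> (P t *v x) \<bullet> x"
    "\<And>t x. t > 0 \<Longrightarrow> (P t *v x) \<bullet> x \<le> C * min 1 t * (norm x)\<^sup>2"
    "\<And>x. c * (norm x)\<^sup>2 \<le> (S *v x) \<bullet> x" "\<And>x. (S *v x) \<bullet> x \<le> C * (norm x)\<^sup>2"
    using cov_bounds by metis
  then show ?thesis
    by (intro that[of c C]) (auto intro!: coercive_matrix.intro cov_symmetric)
qed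

lemma F_nonneg:
  assumes "t > 0" shows "0 \<le> F t x y"
proof -
  obtain c C where c: "coercive_matrix (P t) (c * min 1 t)" "coercive_matrix S c"
    using coercive_cov assms by metis
  show ?thesis unfolding F_def
    using coercive_matrix.inv_antimono[OF c P_le_S]
    by (simp add: matrix_vector_mult_diff_rdistrib inner_diff_left)
qed

text \<open>Both sides are expanded as quadratic polynomials in \<open>y\<close>. With
  \<open>g\<close> the solution of \<open>M^T g = S\<inverse> x\<close>, one has
  \<open>D x = S g\<close>, and \<open>cov_split\<close> gives \<open>M x = S g - P g\<close>.
  Therefore \<open>(P\<inverse> - S\<inverse>) D x = P\<inverse> M x\<close>, that is, the linear
  terms agree; the quadratic terms differ by \<open>2 R y\<close> and the constants by
  \<open>2 R x\<close>.\<close>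

lemma E_eq:
  assumes t: "t > 0"
  shows "E t x y = R y - R x + F t x y"
proof -
  obtain c C where c: "coercive_matrix (P t) (c * min 1 t)" "coercive_matrix S c"
    using coercive_cov t by metis
  interpret P: coercive_matrix "P t" "c * min 1 t" by (rule c)
  interpret S: coercive_matrix S c by (rule c)
  define g where "g = mat_exp (- (t *\<^sub>R transpose B)) *v (matrix_inv S *v x)"
  define z where "z = matrix_inv (P t) *v (M t *v x)"
  define N where "N = matrix_inv (P t) - matrix_inv S"
  define d where "d = ou_D Q B t *v x"
  have d: "d = S *v g"
    by (simp add: d_def ou_D_def g_def matrix_vector_mul_assoc matrix_mul_assoc)
  have tM: "transpose (M t) = mat_exp (t *\<^sub>R transpose B)"
    by (simp add: mat_exp_transpose transpose_scalar)
  have g: "transpose (M t) *v g = matrix_inv S *v x"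
    unfolding tM g_def by (metis mat_exp_minus_mult matrix_vector_mul_assoc matrix_vector_mul_lid)
  have Mx: "M t *v x = S *v g - P t *v g"
  proof -
    have "S - P t = M t ** S ** transpose (M t)" using cov_split[OF t] by (metis add_diff_cancel_left')
    then have "S *v g - P t *v g = M t *v (S *v (transpose (M t) *v g))"
      by (metis matrix_vector_mul_assoc matrix_vector_mult_diff_rdistrib)
    then show ?thesis by (simp only: g S.inv_vector)
  qed
  have Nd: "N *v d = z"
    by (simp add: N_def z_def Mx d matrix_vector_mult_diff_rdistrib matrix_vector_mult_diff_distrib
        S.inv_vector P.inv_vector)
  have Nsym: "(N *v u) \<bullet> v = (N *v v) \<bullet> u" for u v
    using P.inv_symmetric[of u v] S.inv_symmetric[of u v]
    by (simp add: N_def matrix_vector_mult_diff_rdistrib inner_diff_left)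
  have Pz: "P t *v z = M t *v x" by (simp add: z_def P.inv_vector)
  have "z \<bullet> (d - M t *v x) = z \<bullet> (P t *v g)" by (simp add: d Mx)
  also have "\<dots> = (P t *v z) \<bullet> g"
    using inner_symmetric_matrix[OF P.sym, of z g] by (simp add: inner_commute)
  also have "\<dots> = x \<bullet> (transpose (M t) *v g)" by (simp only: Pz inner_matrix_transpose[of "M t" x g])
  also have "\<dots> = x \<bullet> (matrix_inv S *v x)" by (simp only: g)
  finally have key: "z \<bullet> d - z \<bullet> (M t *v x) = x \<bullet> (matrix_inv S *v x)" by (simp add: inner_diff_right)
  have F: "2 * F t x y = (N *v y) \<bullet> y - 2 * (z \<bullet> y) + z \<bullet> d"
    using Nsym[of y d] unfolding F_def N_def[symmetric] d_def[symmetric]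
    by (simp add: matrix_vector_mult_diff_distrib Nd inner_diff_left inner_diff_right)
  have E: "2 * E t x y = (matrix_inv (P t) *v y) \<bullet> y - 2 * (z \<bullet> y) + z \<bullet> (M t *v x)"
    using P.inv_symmetric[of y "M t *v x"] unfolding E_def
    by (simp add: matrix_vector_mult_diff_distrib inner_diff_left inner_diff_right z_def[symmetric])
  have "(N *v y) \<bullet> y = (matrix_inv (P t) *v y) \<bullet> y - 2 * R y"
    by (simp add: N_def ou_R_def matrix_vector_mult_diff_rdistrib inner_diff_left)
  moreover have "x \<bullet> (matrix_inv S *v x) = 2 * R x" by (simp add: ou_R_def inner_commute)
  ultimately show ?thesis using E F key by linarith
qed

lemma R_nonneg: "0 \<le> R x"
proof -
  obtain c C where c: "C > 0" "coercive_matrix S c" "\<And>x. (S *v x) \<bullet> x \<le> C * (norm x)\<^sup>2"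
    using coercive_cov by metis
  have "0 \<le> (norm x)\<^sup>2 / C" using c by simp
  with coercive_matrix.inv_lower[OF c(2,1,3), of x] show ?thesis by (simp add: ou_R_def)
qed

text \<open>By \<open>cov_split\<close> the form of \<open>S\<close> at \<open>M^T w\<close> is that
  of \<open>S - P\<close> at \<open>w\<close>, hence at most \<open>1 - b\<close> times that of
  \<open>S\<close>. Passing to the Legendre dual turns this contraction of \<open>M^T\<close> into
  one of \<open>M t\<close> for the inverse form \<open>R\<close>.\<close>

lemma R_contract:
  assumes t: "t > 0" and b: "0 < b" "b < 1" and bS: "\<And>w. b * ((S *v w) \<bullet> w) \<le> (P t *v w) \<bullet> w"
  shows "R (M t *v x) \<le> (1 - b) * R x"
proof -
  obtain c C where c: "coercive_matrix S c" using coercive_cov by metis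
  interpret S: coercive_matrix S c by (rule c)
  let ?v = "M t *v x"
  let ?w = "matrix_inv S *v ?v"
  let ?u = "transpose (M t) *v ?w"
  \<comment> \<open>The multiplier maximising \<open>4 l r - 2 l^2 (1 - b) r\<close> over
    \<open>l\<close>, where \<open>r = R ?v\<close>.\<close>
  let ?l = "1 / (1 - b)"
  have 1: "?w \<bullet> ?v = 2 * R ?v" by (simp add: ou_R_def)
  have 2: "?u \<bullet> x = 2 * R ?v" using inner_matrix_transpose[of "M t" x ?w] 1 by (simp only: inner_commute)
  have "(S *v ?u) \<bullet> ?u = (S *v ?w) \<bullet> ?w - (P t *v ?w) \<bullet> ?w"
  proof -
    have "S - P t = M t ** S ** transpose (M t)" using cov_split[OF t] by (metis add_diff_cancel_left')
    then have "(S *v ?w) - (P t *v ?w) = M t *v (S *v ?u)"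
      by (metis matrix_vector_mul_assoc matrix_vector_mult_diff_rdistrib)
    then have "((S *v ?w) - (P t *v ?w)) \<bullet> ?w = (S *v ?u) \<bullet> ?u"
      by (simp only: inner_matrix_transpose[of "M t" _ ?w])
    then show ?thesis by (simp add: inner_diff_left)
  qed
  also have "\<dots> \<le> (1 - b) * ((S *v ?w) \<bullet> ?w)" using bS[of ?w] by (simp add: algebra_simps)
  also have "(S *v ?w) \<bullet> ?w = 2 * R ?v" using 1 by (simp add: S.inv_vector inner_commute)
  finally have 3: "(S *v ?u) \<bullet> ?u \<le> (1 - b) * (2 * R ?v)" .
  have "2 * ((?l *\<^sub>R ?u) \<bullet> x) - (S *v (?l *\<^sub>R ?u)) \<bullet> (?l *\<^sub>R ?u) \<le> 2 * R x"
    using S.inv_dual[of "?l *\<^sub>R ?u" x] by (simp add: ou_R_def)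
  then have "2 * ?l * (?u \<bullet> x) - ?l\<^sup>2 * ((S *v ?u) \<bullet> ?u) \<le> 2 * R x"
    unfolding matrix_vector_mult_scaleR inner_scaleR_left inner_scaleR_right
    by (simp only: power2_eq_square mult.assoc)
  moreover have "?l\<^sup>2 * ((S *v ?u) \<bullet> ?u) \<le> ?l\<^sup>2 * ((1 - b) * (2 * R ?v))"
    using 3 by (intro mult_left_mono) auto
  moreover have "?l\<^sup>2 * ((1 - b) * (2 * R ?v)) = ?l * (2 * R ?v)"
    using b by (simp add: power2_eq_square)
  ultimately have "?l * R ?v \<le> R x" unfolding 2 by simp
  then show ?thesis using b by (simp add: field_simps)
qed

text \<open>Young's inequality for the cross term, obtained from
  \<open>R (th v - h) \<ge> 0\<close>. The free weight \<open>th\<close> is later chosen small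
  enough to keep the contraction of \<open>R\<close> under \<open>M t\<close>.\<close>

lemma R_add_le:
  assumes "th > 0"
  shows "R (v + h) \<le> (1 + th) * R v + (1 + 1 / th) * R h"
proof -
  obtain c C where c: "coercive_matrix S c" using coercive_cov by metis
  interpret S: coercive_matrix S c by (rule c)
  let ?r = "\<lambda>u v. (matrix_inv S *v u) \<bullet> v"
  have "0 \<le> R (th *\<^sub>R v - h)" by (rule R_nonneg)
  also have "2 * R (th *\<^sub>R v - h) = th\<^sup>2 * ?r v v - 2 * th * ?r v h + ?r h h"
    using S.inv_symmetric[of h v]
    by (simp add: ou_R_def matrix_vector_mult_diff_distrib matrix_vector_mult_scaleR inner_diff_left
        inner_diff_right power2_eq_square algebra_simps)
  finally have "2 * th * ?r v h \<le> th\<^sup>2 * ?r v v + ?r h h" by simp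
  then have "2 * ?r v h \<le> th * ?r v v + ?r h h / th"
    using assms by (simp add: field_simps power2_eq_square)
  moreover have "2 * R (v + h) = ?r v v + 2 * ?r v h + ?r h h"
    using S.inv_symmetric[of h v]
    by (simp add: ou_R_def matrix_vector_right_distrib inner_add_left inner_add_right)
  ultimately have "2 * R (v + h) \<le> (1 + th) * ?r v v + (1 + 1 / th) * ?r h h"
    by (simp add: algebra_simps)
  then show ?thesis by (simp add: ou_R_def)
qed

text \<open>The mean value inequality handles \<open>t \<le> 1\<close>; boundedness of
  \<open>M t\<close> handles larger times.\<close>

lemma M_minus_id_bound:
  obtains L where "L > 0" "\<And>t x. t > 0 \<Longrightarrow> norm (M t *v x - x) \<le> L * min 1 t * norm x"
proof -
  obtain C where C: "C > 0" "\<And>t. t \<ge> 0 \<Longrightarrow> norm (M t) \<le> C" using M_bounded by blast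
  obtain K where K: "K > 0" "\<And>(A::real^'n^'n) x. norm (A *v x) \<le> K * norm A * norm x"
    using matrix_vector_norm_bound by metis
  obtain K' where K': "K' > 0" "\<And>(A::real^'n^'n) (B::real^'n^'n). norm (A ** B) \<le> norm A * norm B * K'"
    using bounded_bilinear.pos_bounded[OF bounded_bilinear_matrix_mult] by blast
  define D where "D = norm B * C * K'"
  define L where "L = max D (C + norm (mat 1 :: real^'n^'n))"
  have small: "norm (M t - M 0) \<le> D * t" if "t > 0" for t
  proof -
    have "norm (M t - M 0) \<le> D * t - D * 0"
    proof (rule differentiable_bound_general[OF that continuous_on_M _ has_vector_derivative_mat_exp])
      show "continuous_on {0..t} (\<lambda>t. D * t)" by (intro continuous_intros)
      show "((\<lambda>t. D * t) has_vector_derivative D) (at s)" for s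
        by (auto simp: has_real_derivative_iff_has_vector_derivative[symmetric] intro!: derivative_eq_intros)
      fix s assume s: "0 < s" "s < t"
      have "norm (B ** M s) \<le> norm B * norm (M s) * K'" by (rule K')
      also have "\<dots> \<le> D" unfolding D_def
        using C(2)[of s] s K' by (intro mult_right_mono mult_left_mono) auto
      finally show "norm (B ** M s) \<le> D" .
    qed
    then show ?thesis by simp
  qed
  have D: "D \<ge> 0" using C K' by (simp add: D_def)
  have "norm (M t - mat 1) \<le> L * min 1 t" if t: "t > 0" for t
  proof (cases "t \<le> 1")
    case True
    have "D * t \<le> L * t" using t by (intro mult_right_mono) (auto simp: L_def)
    then show ?thesis using True small[OF t] by simp
  next
    case False
    have "norm (M t - mat 1) \<le> norm (M t) + norm (mat 1 :: real^'n^'n)" by (rule norm_triangle_ineq4)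
    then show ?thesis using False C(2)[of t] by (simp add: L_def)
  qed
  moreover have "M t *v x - x = (M t - mat 1) *v x" for t x
    by (simp add: matrix_vector_mult_diff_rdistrib)
  moreover have "norm ((M t - mat 1) *v x) \<le> K * norm (M t - mat 1) * norm x" for t x by (rule K)
  moreover have "K * norm (M t - mat 1) * norm x \<le> K * (L * min 1 t) * norm x"
    if "norm (M t - mat 1) \<le> L * min 1 t" for t x
    using that K(1) by (intro mult_right_mono mult_left_mono) auto
  ultimately have "norm (M t *v x - x) \<le> (K * L) * min 1 t * norm x" if "t > 0" for t x
    using that order_trans by (metis (no_types, lifting) mult.assoc)
  moreover have "K * L > 0" using K C D by (auto simp: L_def less_max_iff_disj intro!: mult_pos_pos add_pos_nonneg)
  ultimately show ?thesis using that by blast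
qed

text \<open>Since \<open>E - \<alpha> (R y - R x) = (1 - \<alpha>) E + \<alpha> F\<close> with \<open>F \<ge> 0\<close>, the weight \<open>\<alpha>\<close> of
  \<open>R y - R x\<close> may be replaced by any smaller \<open>\<beta>\<close>, which makes the quadratic form coercive.\<close>

lemma exponent_lower_bound:
  assumes a: "0 < a" "a < 1"
  obtains d where "d > 0"
    "\<And>t x y. t > 0 \<Longrightarrow> d * (norm (x - y))\<^sup>2 / min 1 t \<le> E t x y - a * (R y - R x)"
proof -
  obtain c C where c: "c > 0" and C: "C > 0"
    and Pt: "\<And>t. t > 0 \<Longrightarrow> coercive_matrix (P t) (c * min 1 t)" and S: "coercive_matrix S c"
    and PC: "\<And>t x. t > 0 \<Longrightarrow> (P t *v x) \<bullet> x \<le> C * min 1 t * (norm x)\<^sup>2"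
    and SC: "\<And>x. (S *v x) \<bullet> x \<le> C * (norm x)\<^sup>2"
    using coercive_cov by metis
  obtain L where L: "L > 0" "\<And>t x. t > 0 \<Longrightarrow> norm (M t *v x - x) \<le> L * min 1 t * norm x"
    using M_minus_id_bound by metis
  \<comment> \<open>\<open>c / C\<close> makes \<open>P t\<close> dominate
    \<open>b0 * min 1 t\<close> times \<open>S\<close>; the cap 1/2 keeps the contraction factor
    positive.\<close>
  define b0 where "b0 = min (c / C) (1/2)"
  have b0: "b0 > 0" "b0 < 1" using c C by (auto simp: b0_def)
  \<comment> \<open>Small enough that the error \<open>be * (3 / b) * R h\<close>, which is of size
    |h|^2 / s, consumes at most half of the lower bound for \<open>(1 - a) * E\<close>.\<close>
  define be where "be = min a ((1 - a) * c * b0 / (6 * C))"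
  have be: "be > 0" "be \<le> a" using a c C b0 by (auto simp: be_def)
  define k1 where "k1 = (1 - a) / (4 * C)"
  define k2 where "k2 = be * b0 / (4 * C)"
  have k: "k1 > 0" "k2 > 0" using a C be b0 by (auto simp: k1_def k2_def)
  \<comment> \<open>The factors 2 come from squaring
    \<open>norm (x - y) \<le> norm h + L * s * norm x\<close>; each of the two squares is then
    absorbed by its own coefficient \<open>k1\<close> or \<open>k2\<close>.\<close>
  define d where "d = min (k1 / 2) (k2 / (2 * L\<^sup>2))"
  have d: "d > 0" using k L by (auto simp: d_def)
  have "d * (norm (x - y))\<^sup>2 / min 1 t \<le> E t x y - a * (R y - R x)" if t: "t > 0" for t x y
  proof -
    define s where "s = min 1 t"
    have s: "0 < s" "s \<le> 1" using t by (auto simp: s_def)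
    define h where "h = y - M t *v x"
    define b where "b = b0 * s"
    have b: "0 < b" "b < 1" using b0 s unfolding b_def
      by (auto intro: le_less_trans[OF mult_left_le])
    interpret Pt: coercive_matrix "P t" "c * min 1 t" by (rule Pt[OF t])
    interpret S: coercive_matrix S c by (rule S)
    have E_lo: "(norm h)\<^sup>2 / (2 * C * s) \<le> E t x y"
      using Pt.inv_lower[of "C * s" h] PC[OF t] C s by (simp add: E_def h_def[symmetric] s_def)
    have Rh: "R h \<le> (norm h)\<^sup>2 / (2 * c)"
      using S.inv_upper[of h] by (simp add: ou_R_def)
    have Rx: "(norm x)\<^sup>2 / (2 * C) \<le> R x"
      using S.inv_lower[OF C SC, of x] by (simp add: ou_R_def)
    have "b * ((S *v w) \<bullet> w) \<le> (P t *v w) \<bullet> w" for w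
    proof -
      have "b * ((S *v w) \<bullet> w) \<le> b * (C * (norm w)\<^sup>2)" using b SC by (intro mult_left_mono) auto
      also have "\<dots> \<le> (c / C * s) * (C * (norm w)\<^sup>2)"
        using s C unfolding b_def b0_def by (intro mult_right_mono) auto
      also have "\<dots> = c * min 1 t * (norm w)\<^sup>2" using C by (simp add: s_def)
      also have "\<dots> \<le> (P t *v w) \<bullet> w" by (rule Pt.coercive)
      finally show ?thesis .
    qed
    from R_contract[OF t b this] have RM: "R (M t *v x) \<le> (1 - b) * R x" .
    have "R y = R (M t *v x + h)" by (simp add: h_def)
    \<comment> \<open>The weight \<open>b/2\<close> is affordable because
      \<open>(1 + b/2) (1 - b) \<le> 1 - b/2\<close>: half of the contraction remains.\<close>
    also have "\<dots> \<le> (1 + b/2) * R (M t *v x) + (1 + 1 / (b/2)) * R h" using b by (intro R_add_le) auto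
    also have "\<dots> \<le> (1 - b/2) * R x + 3 / b * R h"
    proof (rule add_mono)
      have "(1 + b/2) * R (M t *v x) \<le> (1 + b/2) * ((1 - b) * R x)"
        using RM b by (intro mult_left_mono) auto
      also have "\<dots> = (1 - b/2) * R x - (b * b / 2) * R x" by (simp add: algebra_simps)
      also have "\<dots> \<le> (1 - b/2) * R x" using b R_nonneg[of x] by simp
      finally show "(1 + b/2) * R (M t *v x) \<le> (1 - b/2) * R x" .
      show "(1 + 1 / (b/2)) * R h \<le> 3 / b * R h"
        using b R_nonneg[of h] by (intro mult_right_mono) (auto simp: field_simps)
    qed
    finally have diff: "R y - R x \<le> 3 / b * R h - b / 2 * R x" by (simp add: algebra_simps)
    have "R y - R x \<le> E t x y" using E_eq[OF t, of x y] F_nonneg[OF t, of x y] by simp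
    then have "(a - be) * (R y - R x) \<le> (a - be) * E t x y" using be by (intro mult_left_mono) auto
    then have G: "(1 - a) * E t x y + be * (E t x y - (R y - R x)) \<le> E t x y - a * (R y - R x)"
      by (simp add: algebra_simps)
    have E0: "0 \<le> E t x y"
      using E_lo C s by (meson divide_nonneg_nonneg order_trans zero_le_power2 mult_nonneg_nonneg less_imp_le zero_le_numeral)
    \<comment> \<open>Bookkeeping: \<open>V\<close> is the share of \<open>E\<close>, worth two
      copies of \<open>K\<close>. One copy pays for the error \<open>Y\<close> in
      \<open>R h\<close>; the other survives together with the gain \<open>X\<close> in
      \<open>R x\<close>.\<close>
    have arith: "K + K2 \<le> G'" if "Z \<le> W" "Z = X - Y" "Y \<le> K" "K2 \<le> X" "2 * K \<le> V" "V + W \<le> G'"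
      for K K2 G' Z W X Y V :: real
      using that by linarith
    have "be * (b / 2 * R x - 3 / b * R h) \<le> be * (E t x y - (R y - R x))"
      using diff be E0 by (intro mult_left_mono) auto
    moreover have "be * (3 / b * R h) \<le> k1 * (norm h)\<^sup>2 / s"
    proof -
      have "be * (3 / b * R h) \<le> ((1 - a) * c * b0 / (6 * C)) * (3 / b * ((norm h)\<^sup>2 / (2 * c)))"
        using Rh b R_nonneg[of h] a c C b0 by (intro mult_mono) (auto simp: be_def)
      also have "\<dots> = k1 * (norm h)\<^sup>2 / s"
        using c C b0 s by (simp add: k1_def b_def field_simps)
      finally show ?thesis .
    qed
    moreover have "k2 * s * (norm x)\<^sup>2 \<le> be * (b / 2 * R x)"
    proof -
      have "k2 * s * (norm x)\<^sup>2 = be * (b / 2 * ((norm x)\<^sup>2 / (2 * C)))"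
        by (simp add: k2_def b_def)
      also have "\<dots> \<le> be * (b / 2 * R x)" using Rx be b by (intro mult_left_mono) auto
      finally show ?thesis .
    qed
    moreover have "2 * (k1 * (norm h)\<^sup>2 / s) \<le> (1 - a) * E t x y"
    proof -
      have "2 * (k1 * (norm h)\<^sup>2 / s) = (1 - a) * ((norm h)\<^sup>2 / (2 * C * s))"
        by (simp add: k1_def)
      also have "\<dots> \<le> (1 - a) * E t x y" using E_lo a by (intro mult_left_mono) auto
      finally show ?thesis .
    qed
    ultimately have main: "k1 * (norm h)\<^sup>2 / s + k2 * s * (norm x)\<^sup>2 \<le> E t x y - a * (R y - R x)"
      by (intro arith[OF _ right_diff_distrib _ _ _ G])
    have "norm (x - y) \<le> norm h + L * s * norm x"
    proof -
      have "x - y = - (h + (M t *v x - x))" by (simp add: h_def)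
      then have "norm (x - y) = norm (h + (M t *v x - x))" by (simp only: norm_minus_cancel)
      also have "\<dots> \<le> norm h + norm (M t *v x - x)" by (rule norm_triangle_ineq)
      finally show ?thesis using L(2)[OF t, of x] by (simp add: s_def)
    qed
    then have "(norm (x - y))\<^sup>2 \<le> (norm h + L * s * norm x)\<^sup>2" by (intro power_mono) auto
    also have "\<dots> \<le> 2 * (norm h)\<^sup>2 + 2 * (L * s * norm x)\<^sup>2"
      using sum_squares_bound[of "norm h" "L * s * norm x"] by (simp add: power2_sum)
    finally have "d * (norm (x - y))\<^sup>2 \<le> d * (2 * (norm h)\<^sup>2 + 2 * (L * s * norm x)\<^sup>2)"
      using d by (intro mult_left_mono) auto
    also have "\<dots> = (d * 2) * (norm h)\<^sup>2 + (d * (2 * L\<^sup>2)) * (s * norm x)\<^sup>2"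
      by (simp add: power_mult_distrib algebra_simps)
    also have "\<dots> \<le> k1 * (norm h)\<^sup>2 + k2 * (s * norm x)\<^sup>2"
    proof (intro add_mono mult_right_mono)
      show "d * 2 \<le> k1" by (simp add: d_def)
      have "d \<le> k2 / (2 * L\<^sup>2)" by (simp add: d_def)
      then show "d * (2 * L\<^sup>2) \<le> k2" using L by (simp add: field_simps)
    qed auto
    finally have "d * (norm (x - y))\<^sup>2 / s \<le> (k1 * (norm h)\<^sup>2 + k2 * (s * norm x)\<^sup>2) / s"
      using s by (intro divide_right_mono) auto
    also have "\<dots> = k1 * (norm h)\<^sup>2 / s + k2 * s * (norm x)\<^sup>2"
      using s by (simp add: field_simps power2_eq_square)
    finally show ?thesis using main by (simp add: s_def)
  qed
  with d show ?thesis using that by blast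
qed

text \<open>Absolute values are used throughout because \<open>det_lower\<close> controls the
  determinant in modulus; the real \<open>sqrt\<close> is odd, so it commutes with the modulus. The
  summand 1 in \<open>C\<close> keeps the constant positive.\<close>

lemma mehler_prefactor_bound:
  obtains C where "C > 0" "\<And>t. t > 0 \<Longrightarrow> \<bar>sqrt (det S / det (P t))\<bar> \<le> C / sqrt (min 1 t) ^ CARD('n)"
proof -
  obtain c where c: "c > 0" and Pt: "\<And>t. t > 0 \<Longrightarrow> coercive_matrix (P t) (c * min 1 t)"
    using coercive_cov by metis
  let ?f = "fact CARD('n) :: real"
  define C where "C = (sqrt \<bar>det S\<bar> + 1) * sqrt ?f / sqrt c ^ CARD('n)"
  have "\<bar>sqrt (det S / det (P t))\<bar> \<le> C / sqrt (min 1 t) ^ CARD('n)" if t: "t > 0" for t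
  proof -
    have "sqrt ((c * min 1 t) ^ CARD('n) / ?f) \<le> sqrt \<bar>det (P t)\<bar>"
      using coercive_matrix.det_lower[OF Pt[OF t]] by (rule real_sqrt_le_mono)
    then have *: "sqrt c ^ CARD('n) * sqrt (min 1 t) ^ CARD('n) / sqrt ?f \<le> sqrt \<bar>det (P t)\<bar>"
      by (simp add: real_sqrt_power real_sqrt_mult real_sqrt_divide power_mult_distrib)
    have "\<bar>sqrt (det S / det (P t))\<bar> = sqrt \<bar>det S\<bar> / sqrt \<bar>det (P t)\<bar>"
      by (simp add: sqrt_def real_root_abs[symmetric] abs_divide real_root_divide)
    also have "\<dots> \<le> (sqrt \<bar>det S\<bar> + 1) / (sqrt c ^ CARD('n) * sqrt (min 1 t) ^ CARD('n) / sqrt ?f)"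
      using * c t by (intro frac_le) auto
    finally show ?thesis by (simp add: C_def)
  qed
  moreover have "C > 0" using c by (auto simp: C_def intro!: divide_pos_pos mult_pos_pos add_nonneg_pos)
  ultimately show ?thesis using that by blast
qed

lemma mehler_kernel_eq: "mehler_kernel Q B t x y = sqrt (det S / det (P t)) * exp (R x) * exp (- F t x y)"
  by (simp add: mehler_kernel_def F_def)

lemma mehler_weighted_eq:
  assumes "t > 0"
  shows "mehler_kernel Q B t x y * exp (- R y) = sqrt (det S / det (P t)) * exp (- E t x y)"
proof -
  have "exp (R x) * exp (- F t x y) * exp (- R y) = exp (- E t x y)"
    by (simp add: E_eq[OF assms] flip: exp_add)
  then show ?thesis by (simp add: mehler_kernel_eq mult.assoc)
qed

text \<open>From \<open>F \<ge> 0\<close>. The bound is independent of \<open>y\<close> and uniform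
  for \<open>t\<close> away from 0, so it supplies the integrable majorant for continuity in
  time.\<close>

lemma mehler_kernel_le:
  obtains C where "C > 0" "\<And>t x y. t > 0 \<Longrightarrow> \<bar>mehler_kernel Q B t x y\<bar> \<le> C / sqrt (min 1 t) ^ CARD('n) * exp (R x)"
proof -
  obtain C where C: "C > 0" "\<And>t. t > 0 \<Longrightarrow> \<bar>sqrt (det S / det (P t))\<bar> \<le> C / sqrt (min 1 t) ^ CARD('n)"
    using mehler_prefactor_bound by metis
  have "\<bar>mehler_kernel Q B t x y\<bar> \<le> C / sqrt (min 1 t) ^ CARD('n) * exp (R x)" if t: "t > 0" for t x y
  proof -
    have "\<bar>mehler_kernel Q B t x y\<bar> = \<bar>sqrt (det S / det (P t))\<bar> * exp (R x) * exp (- F t x y)"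
      by (simp add: mehler_kernel_eq abs_mult)
    also have "\<dots> \<le> C / sqrt (min 1 t) ^ CARD('n) * exp (R x) * 1"
      using C t F_nonneg[OF t, of x y] by (intro mult_mono) auto
    finally show ?thesis by simp
  qed
  with C(1) show ?thesis using that by blast
qed

text \<open>Applied with \<open>a = 1/p\<close>. The result is a Gaussian in \<open>x - y\<close>,
  centred at \<open>x\<close> with width \<open>sqrt (min 1 t)\<close>, as needed for comparison
  with averages over balls around \<open>x\<close>.\<close>

lemma mehler_conjugated_le:
  assumes a: "0 < a" "a < 1"
  obtains C d where "C > 0" "d > 0"
    "\<And>t x y. t > 0 \<Longrightarrow> \<bar>mehler_kernel Q B t x y\<bar> * exp (- R y) * exp (a * (R y - R x)) \<le>
       C / sqrt (min 1 t) ^ CARD('n) * exp (- d * (norm (x - y))\<^sup>2 / min 1 t)"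
proof -
  obtain C where C: "C > 0" "\<And>t. t > 0 \<Longrightarrow> \<bar>sqrt (det S / det (P t))\<bar> \<le> C / sqrt (min 1 t) ^ CARD('n)"
    using mehler_prefactor_bound by metis
  obtain d where d: "d > 0"
    "\<And>t x y. t > 0 \<Longrightarrow> d * (norm (x - y))\<^sup>2 / min 1 t \<le> E t x y - a * (R y - R x)"
    using exponent_lower_bound[OF a] by metis
  have "\<bar>mehler_kernel Q B t x y\<bar> * exp (- R y) * exp (a * (R y - R x)) \<le>
       C / sqrt (min 1 t) ^ CARD('n) * exp (- d * (norm (x - y))\<^sup>2 / min 1 t)" if t: "t > 0" for t x y
  proof -
    have "\<bar>mehler_kernel Q B t x y\<bar> * exp (- R y) = \<bar>sqrt (det S / det (P t))\<bar> * exp (- E t x y)"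
      using mehler_weighted_eq[OF t, of x y] by (metis abs_exp_cancel abs_mult)
    then have "\<bar>mehler_kernel Q B t x y\<bar> * exp (- R y) * exp (a * (R y - R x)) =
        \<bar>sqrt (det S / det (P t))\<bar> * exp (- (E t x y - a * (R y - R x)))"
      by (simp add: mult.assoc flip: exp_add)
    also have "\<dots> \<le> C / sqrt (min 1 t) ^ CARD('n) * exp (- d * (norm (x - y))\<^sup>2 / min 1 t)"
      using C t d(2)[OF t, of x y] by (intro mult_mono) auto
    finally show ?thesis .
  qed
  with C(1) d(1) show ?thesis using that by blast
qed

text \<open>Keeps the centre \<open>M t *v x\<close>, which may be far from \<open>x\<close>. This
  is enough to bound the Lebesgue mass of the kernel uniformly in \<open>t\<close> and
  \<open>x\<close>.\<close>

lemma mehler_weighted_le: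
  obtains C d where "C > 0" "d > 0"
    "\<And>t x y. t > 0 \<Longrightarrow> \<bar>mehler_kernel Q B t x y\<bar> * exp (- R y) \<le>
       C / sqrt (min 1 t) ^ CARD('n) * exp (- d * (norm (y - M t *v x))\<^sup>2 / min 1 t)"
proof -
  obtain C where C: "C > 0" "\<And>t. t > 0 \<Longrightarrow> \<bar>sqrt (det S / det (P t))\<bar> \<le> C / sqrt (min 1 t) ^ CARD('n)"
    using mehler_prefactor_bound by metis
  obtain c D where D: "D > 0"
    and Pt: "\<And>t. t > 0 \<Longrightarrow> coercive_matrix (P t) (c * min 1 t)"
    and PC: "\<And>t x. t > 0 \<Longrightarrow> (P t *v x) \<bullet> x \<le> D * min 1 t * (norm x)\<^sup>2"
    using coercive_cov by metis
  have "\<bar>mehler_kernel Q B t x y\<bar> * exp (- R y) \<le>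
       C / sqrt (min 1 t) ^ CARD('n) * exp (- (1 / (2 * D)) * (norm (y - M t *v x))\<^sup>2 / min 1 t)" if t: "t > 0" for t x y
  proof -
    have "(norm (y - M t *v x))\<^sup>2 / (D * min 1 t) \<le> 2 * E t x y"
      using coercive_matrix.inv_lower[OF Pt[OF t] _ PC[OF t], of "y - M t *v x"] D t by (simp add: E_def)
    then have *: "(1 / (2 * D)) * (norm (y - M t *v x))\<^sup>2 / min 1 t \<le> E t x y" by simp
    have "\<bar>mehler_kernel Q B t x y\<bar> * exp (- R y) = \<bar>sqrt (det S / det (P t))\<bar> * exp (- E t x y)"
      using mehler_weighted_eq[OF t, of x y] by (metis abs_exp_cancel abs_mult)
    also have "\<dots> \<le> C / sqrt (min 1 t) ^ CARD('n) * exp (- (1 / (2 * D)) * (norm (y - M t *v x))\<^sup>2 / min 1 t)"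
      using C t * by (intro mult_mono) auto
    finally show ?thesis .
  qed
  with C(1) D show ?thesis using that[of C "1 / (2 * D)"] by auto
qed

text \<open>Read off from \<open>cov_split\<close>, which expresses \<open>P t\<close> through the
  continuous function \<open>M t\<close>.\<close>

lemma continuous_on_P: "continuous_on {0<..} P"
proof -
  have "continuous_on {0<..} (\<lambda>t. S - M t ** S ** transpose (M t))"
    by (intro continuous_intros bounded_bilinear.continuous_on[OF bounded_bilinear_matrix_mult]
        continuous_on_M continuous_on_transpose_M)
  moreover have "P t = S - M t ** S ** transpose (M t)" if "t \<in> {0<..}" for t
    using cov_split[of t] that by (metis add_diff_cancel_right' greaterThan_iff)
  ultimately show ?thesis by (rule continuous_on_eq[OF _ sym]) simp
qed

lemma det_P_nonzero: "t > 0 \<Longrightarrow> det (P t) \<noteq> 0"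
proof -
  assume t: "t > 0"
  obtain c where c: "c > 0" "coercive_matrix (P t) (c * min 1 t)" using coercive_cov t by metis
  have "0 < (c * min 1 t) ^ CARD('n) / fact CARD('n)" using c t by simp
  with coercive_matrix.det_lower[OF c(2)] show ?thesis by auto
qed

lemma det_S_nonzero: "det S \<noteq> 0"
proof -
  obtain c where c: "c > 0" "coercive_matrix S c" using coercive_cov by metis
  have "0 < c ^ CARD('n) / fact CARD('n)" using c by simp
  with coercive_matrix.det_lower[OF c(2)] show ?thesis by auto
qed

lemma continuous_on_mehler_time: "continuous_on {0<..} (\<lambda>t. mehler_kernel Q B t x y)"
proof -
  have D: "continuous_on {0<..} (\<lambda>t. ou_D Q B t *v x)"
    using continuous_on_mat_exp[of "{0<..}" "- transpose B"] unfolding ou_D_def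
    by (intro bounded_bilinear.continuous_on[OF bounded_bilinear_matrix_mult]
        bounded_bilinear.continuous_on[OF bounded_bilinear_matrix_vector_mult] continuous_on_const) simp
  show ?thesis
    unfolding mehler_kernel_def matrix_vector_mult_diff_rdistrib
    by (intro continuous_intros continuous_on_matrix_inv_vector continuous_on_P D continuous_on_det
        bounded_bilinear.continuous_on[OF bounded_bilinear_matrix_vector_mult])
      (auto simp: det_P_nonzero)
qed

lemma continuous_on_mehler_space: "continuous_on UNIV (\<lambda>(x, y). mehler_kernel Q B t x y)"
  unfolding mehler_kernel_def ou_R_def case_prod_beta
  by (intro continuous_intros bounded_bilinear.continuous_on[OF bounded_bilinear_matrix_vector_mult])

end

section \<open>The Hardy-Littlewood maximal function\<close>

text \<open>Normalised by \<open>r ^ DIM('a)\<close> instead of the volume, so the unit ball volume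
  \<open>V\<close> reappears in the estimates; for instance, the constant function 1 has averages
  \<open>V\<close>.\<close>

definition ball_avg :: "('a::euclidean_space \<Rightarrow> ennreal) \<Rightarrow> 'a \<Rightarrow> real \<Rightarrow> ennreal" where
  "ball_avg g z r = ennreal (1 / r ^ DIM('a)) * (\<integral>\<^sup>+y. g y * indicator (ball z r) y \<partial>lborel)"

text \<open>Uncentred: superlevel sets are unions of open balls, so the function is Borel for
  arbitrary \<open>g\<close>. Membership of \<open>x\<close> in the ball forces
  \<open>r > 0\<close>.\<close>

definition hl_maximal :: "('a::euclidean_space \<Rightarrow> ennreal) \<Rightarrow> 'a \<Rightarrow> ennreal" where
  "hl_maximal g x = (SUP (z, r)\<in>{(z, r). x \<in> ball z r}. ball_avg g z r)"

lemma hl_maximal_superlevel: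
  "{x. l < hl_maximal g x} = (\<Union>(z, r)\<in>{(z, r). 0 < r \<and> l < ball_avg g z r}. ball z r)"
proof -
  have "0 < r" if "x \<in> ball z r" for x z :: 'a and r
    using that by (metis mem_ball order.strict_trans1 zero_le_dist)
  then show ?thesis
    unfolding hl_maximal_def by (auto simp: less_SUP_iff simp del: mem_ball) blast+
qed

lemma hl_maximal_measurable [measurable]: "hl_maximal g \<in> borel_measurable borel"
proof (rule borel_measurableI_greater)
  fix l
  have "open {x. l < hl_maximal g x}"
    unfolding hl_maximal_superlevel by (intro open_UN) auto
  then show "{x \<in> space borel. l < hl_maximal g x} \<in> sets borel" by simp
qed

text \<open>The Vitali covering argument: each ball in the superlevel set has large
  \<open>g\<close>-mass compared with its volume, a disjoint subfamily enlarged five times still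
  covers, and disjointness bounds the total \<open>g\<close>-mass.\<close>

lemma hl_maximal_weak_type:
  fixes g :: "'a::euclidean_space \<Rightarrow> ennreal"
  assumes g [measurable]: "g \<in> borel_measurable borel" and l: "l > 0"
  shows "ennreal l * emeasure lborel {x. ennreal l < hl_maximal g x} \<le>
    ennreal (unit_ball_vol (DIM('a)) * 5 ^ DIM('a)) * (\<integral>\<^sup>+y. g y \<partial>lborel)"
proof (cases "(\<integral>\<^sup>+y. g y \<partial>lborel) = top")
  case True
  have "unit_ball_vol (real DIM('a)) \<noteq> 0" by (rule less_imp_neq[symmetric]) simp
  with True show ?thesis by (simp add: ennreal_mult_top)
next
  case False
  then obtain I where I: "(\<integral>\<^sup>+y. g y \<partial>lborel) = ennreal I" "0 \<le> I"
    by (cases "\<integral>\<^sup>+y. g y \<partial>lborel") auto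
  define n where "n = DIM('a)"
  define V where "V = unit_ball_vol (real n)"
  have V: "V > 0" by (simp add: V_def)
  \<comment> \<open>As a measure, \<open>g\<close> turns the sum of its masses on disjoint balls
    into the mass of their union.\<close>
  let ?nu = "density lborel g"
  define K where "K = {(z :: 'a, r). 0 < r \<and> ennreal l < ball_avg g z r}"
  have avg: "l * r ^ n \<le> I" "ennreal (l * r ^ n) \<le> emeasure ?nu (ball z r)" "r > 0"
    if "(z, r) \<in> K" for z r
  proof -
    have r: "r > 0" and *: "ennreal l < ball_avg g z r" using that by (auto simp: K_def)
    have "ennreal (l * r ^ n) = ennreal (r ^ n) * ennreal l"
      using l r by (simp add: ennreal_mult'[symmetric] mult.commute)
    also have "\<dots> \<le> ennreal (r ^ n) * ball_avg g z r"
      using * by (intro mult_left_mono) auto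
    also have "\<dots> = ennreal (r ^ n) * ennreal (1 / r ^ n) * (\<integral>\<^sup>+y. g y * indicator (ball z r) y \<partial>lborel)"
      by (simp add: ball_avg_def n_def mult.assoc)
    also have "ennreal (r ^ n) * ennreal (1 / r ^ n) = 1"
      using r by (simp add: ennreal_mult'[symmetric])
    finally have 1: "ennreal (l * r ^ n) \<le> (\<integral>\<^sup>+y. g y * indicator (ball z r) y \<partial>lborel)" by simp
    then show "ennreal (l * r ^ n) \<le> emeasure ?nu (ball z r)" by (simp add: emeasure_density)
    have "ennreal (l * r ^ n) \<le> ennreal I"
      using 1 unfolding I(1)[symmetric]
      by (rule order_trans) (intro nn_integral_mono, simp add: indicator_def)
    then show "l * r ^ n \<le> I" using I(2) by simp
    show "r > 0" by fact
  qed
  \<comment> \<open>Vitali's lemma requires bounded radii. Since \<open>l * r ^ n \<le> I\<close>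
    and \<open>r \<le> r ^ n\<close> for \<open>r > 1\<close>, finiteness of the integral supplies
    the bound.\<close>
  have rb: "0 < snd k \<and> snd k \<le> max 1 (I / l)" if "k \<in> K" for k
  proof -
    obtain z r where k: "k = (z, r)" by (cases k)
    note a = avg[of z r, OF that[unfolded k]]
    have "r \<le> max 1 (I / l)"
    proof (cases "r \<le> 1")
      case False
      then have "r \<le> r ^ n" by (intro self_le_power) (auto simp: n_def)
      also have "\<dots> \<le> I / l" using a(1) l by (simp add: field_simps)
      finally show ?thesis by simp
    qed simp
    then show ?thesis using a(3) k by simp
  qed
  have U: "{x. ennreal l < hl_maximal g x} \<subseteq> (\<Union>k\<in>K. ball (fst k) (snd k))"
    unfolding hl_maximal_superlevel K_def by force
  obtain C where C: "countable C" "C \<subseteq> K"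
    "pairwise (\<lambda>i j. disjnt (ball (fst i) (snd i)) (ball (fst j) (snd j))) C"
    "{x. ennreal l < hl_maximal g x} \<subseteq> (\<Union>k\<in>C. ball (fst k) (5 * snd k))"
    by (rule Vitali_covering_lemma_balls[OF U rb]) (assumption | rule that)+
  \<comment> \<open>Countable subadditivity, written as an exchange of Lebesgue and counting
    integrals over the index set \<open>C\<close>.\<close>
  have "emeasure lborel {x. ennreal l < hl_maximal g x}
      \<le> (\<integral>\<^sup>+x. (\<integral>\<^sup>+k. indicator (ball (fst k) (5 * snd k)) x \<partial>count_space C) \<partial>lborel)"
  proof -
    have "emeasure lborel {x. ennreal l < hl_maximal g x} = (\<integral>\<^sup>+x. indicator {x. ennreal l < hl_maximal g x} x \<partial>lborel)"
      by (rule nn_integral_indicator[symmetric]) measurable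
    also have "\<dots> \<le> (\<integral>\<^sup>+x. (\<integral>\<^sup>+k. indicator (ball (fst k) (5 * snd k)) x \<partial>count_space C) \<partial>lborel)"
    proof (rule nn_integral_mono)
      fix x
      show "indicator {x. ennreal l < hl_maximal g x} x
        \<le> (\<integral>\<^sup>+k. indicator (ball (fst k) (5 * snd k)) x \<partial>count_space C)"
      proof (cases "x \<in> {x. ennreal l < hl_maximal g x}")
        case True
        then obtain k where k: "k \<in> C" "x \<in> ball (fst k) (5 * snd k)" using C(4) by blast
        then show ?thesis
          using nn_integral_ge_point[of k C "\<lambda>k. indicator (ball (fst k) (5 * snd k)) x"] True by simp
      qed simp
    qed
    finally show ?thesis .
  qed
  also have "\<dots> = (\<integral>\<^sup>+k. (\<integral>\<^sup>+x. indicator (ball (fst k) (5 * snd k)) x \<partial>lborel) \<partial>count_space C)"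
    by (rule nn_integral_count_space_nn_integral[OF C(1)]) (simp add: borel_measurable_indicator)
  finally have "ennreal l * emeasure lborel {x. ennreal l < hl_maximal g x} \<le>
      ennreal l * (\<integral>\<^sup>+k. emeasure lborel (ball (fst k) (5 * snd k)) \<partial>count_space C)"
    by (intro mult_left_mono) simp_all
  also have "\<dots> = (\<integral>\<^sup>+k. ennreal l * emeasure lborel (ball (fst k) (5 * snd k)) \<partial>count_space C)"
    by (rule nn_integral_cmult[symmetric]) simp
  also have "\<dots> \<le> (\<integral>\<^sup>+k. ennreal (V * 5 ^ n) * emeasure ?nu (ball (fst k) (snd k)) \<partial>count_space C)"
  proof (rule nn_integral_mono)
    fix k assume "k \<in> space (count_space C)"
    then have k: "(fst k, snd k) \<in> K" using C(2) by auto
    have "ennreal l * emeasure lborel (ball (fst k) (5 * snd k)) = ennreal (V * 5 ^ n) * ennreal (l * snd k ^ n)"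
      using avg(3)[OF k] l V
      by (simp add: emeasure_ball V_def n_def power_mult_distrib ennreal_mult'[symmetric] mult_ac)
    also have "\<dots> \<le> ennreal (V * 5 ^ n) * emeasure ?nu (ball (fst k) (snd k))"
      by (intro mult_left_mono avg(2)[OF k]) simp
    finally show "ennreal l * emeasure lborel (ball (fst k) (5 * snd k)) \<le> \<dots>" .
  qed
  also have "\<dots> = ennreal (V * 5 ^ n) * (\<integral>\<^sup>+k. emeasure ?nu (ball (fst k) (snd k)) \<partial>count_space C)"
    by (rule nn_integral_cmult) simp
  also have "(\<integral>\<^sup>+k. emeasure ?nu (ball (fst k) (snd k)) \<partial>count_space C) = emeasure ?nu (\<Union>k\<in>C. ball (fst k) (snd k))"
    using C(3) by (intro emeasure_UN_countable[symmetric] C(1))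
      (auto simp: disjoint_family_on_def pairwise_def disjnt_def)
  also have "\<dots> \<le> emeasure ?nu UNIV" using emeasure_space[of ?nu] by simp
  also have "\<dots> = (\<integral>\<^sup>+y. g y \<partial>lborel)" by (subst emeasure_density) auto
  finally show ?thesis by (simp add: V_def n_def mult_left_mono)
qed

section \<open>Powers on [0, \<infinity>], the layer-cake formula and interpolation\<close>

lemma ennpow_top [simp]: "ennpow top p = top"
  by (simp add: ennpow_def)

lemma ennpow_ennreal: "0 \<le> a \<Longrightarrow> ennpow (ennreal a) p = ennreal (a powr p)"
  by (simp add: ennpow_def)

lemma ennpow_mono:
  assumes "a \<le> b" "p \<ge> 0" shows "ennpow a p \<le> ennpow b p"
proof (cases "b = top")
  case False
  then have "a \<noteq> top" using assms(1) by (auto simp: top_unique)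
  with False assms show ?thesis
    by (auto simp: ennpow_def intro!: ennreal_leI powr_mono2 enn2real_mono simp: less_top)
qed simp

lemma ennpow_mult:
  assumes "0 < c" "0 < p" shows "ennpow (ennreal c * a) p = ennreal (c powr p) * ennpow a p"
proof (cases a)
  case (real r)
  then show ?thesis using assms
    by (simp add: ennpow_ennreal powr_mult flip: ennreal_mult')
next
  case top
  then show ?thesis using assms by (simp add: ennreal_mult_top)
qed

lemma nn_integral_layer_cake_real:
  assumes q: "q > 0" and a: "a \<ge> 0"
  shows "(\<integral>\<^sup>+s. ennreal (q * s powr (q - 1)) * indicator {0<..<a} s \<partial>lborel) = ennreal (a powr q)"
proof -
  have "((\<lambda>s. q * s powr (q - 1)) has_integral q * (a powr (q - 1 + 1) / (q - 1 + 1))) {0..a}"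
    using q a by (intro has_integral_mult_right has_integral_powr_from_0) auto
  then have "((\<lambda>s. q * s powr (q - 1)) has_integral (a powr q)) {0..a}" using q by simp
  then have "(\<integral>\<^sup>+s. ennreal (indicator {0..a} s * (q * s powr (q - 1))) \<partial>lborel) = ennreal (a powr q)"
    using q by (intro nn_integral_has_integral_lebesgue) auto
  moreover have "AE s in lborel. ennreal (q * s powr (q - 1)) * indicator {0<..<a} s =
      ennreal (indicator {0..a} s * (q * s powr (q - 1)))"
    using AE_lborel_singleton[of a] by eventually_elim (auto simp: indicator_def)
  ultimately show ?thesis by (simp cong: nn_integral_cong_AE)
qed

lemma ennpow_le_layer_cake:
  assumes q: "q > 0"
  shows "ennpow a q \<le> (\<integral>\<^sup>+s. ennreal (q * s powr (q - 1)) * indicator {s. 0 < s \<and> ennreal s < a} s \<partial>lborel)"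
proof (cases a)
  case (real r)
  then have "{s. 0 < s \<and> ennreal s < a} = {0<..<r}" by (auto simp: ennreal_less_iff)
  then show ?thesis using real nn_integral_layer_cake_real[OF q] by (simp add: ennpow_ennreal)
next
  case top
  \<comment> \<open>At the value \<open>top\<close> the layers up to height
    \<open>k powr (1 / q)\<close> already contribute \<open>k\<close>, for every
    \<open>k\<close>.\<close>
  have "ennreal (real k) \<le> (\<integral>\<^sup>+s. ennreal (q * s powr (q - 1)) * indicator {s. 0 < s \<and> ennreal s < a} s \<partial>lborel)" for k :: nat
  proof -
    have "ennreal (real k) = ennreal ((real k powr (1 / q)) powr q)" using q by (simp add: powr_powr)
    also have "\<dots> = (\<integral>\<^sup>+s. ennreal (q * s powr (q - 1)) * indicator {0<..<real k powr (1 / q)} s \<partial>lborel)"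
      by (rule nn_integral_layer_cake_real[symmetric, OF q]) simp
    also have "\<dots> \<le> (\<integral>\<^sup>+s. ennreal (q * s powr (q - 1)) * indicator {s. 0 < s \<and> ennreal s < a} s \<partial>lborel)"
      using top by (intro nn_integral_mono mult_left_mono) (auto simp: indicator_def)
    finally show ?thesis .
  qed
  then have "top \<le> (\<integral>\<^sup>+s. ennreal (q * s powr (q - 1)) * indicator {s. 0 < s \<and> ennreal s < a} s \<partial>lborel)"
    unfolding ennreal_SUP_of_nat_eq_top[symmetric] by (intro SUP_least) (simp add: ennreal_of_nat_eq_real_of_nat)
  then show ?thesis by (simp add: top_unique)
qed

text \<open>The discarded part of \<open>g\<close> is at most \<open>s / (2 V)\<close>, so it
  contributes at most \<open>s / 2\<close> to any \<open>ball_avg\<close>; the remaining half of the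
  level must come from \<open>h\<close>.\<close>

lemma hl_maximal_truncate:
  fixes g :: "'a::euclidean_space \<Rightarrow> real"
  assumes [measurable]: "g \<in> borel_measurable borel" and g: "\<And>x. 0 \<le> g x"
    and s: "s > 0" and big: "ennreal s < hl_maximal (\<lambda>x. ennreal (g x)) x"
  defines "h \<equiv> \<lambda>x. if s < 2 * unit_ball_vol DIM('a) * g x then ennreal (g x) else 0"
  shows "ennreal (s / 2) < hl_maximal h x"
proof -
  let ?V = "unit_ball_vol DIM('a)"
  have V: "?V > 0" by simp
  then have V0: "?V \<noteq> 0" by (rule less_imp_neq[symmetric])
  obtain z r where zr: "x \<in> ball z r" "ennreal s < ball_avg (\<lambda>x. ennreal (g x)) z r"
    using big by (auto simp: hl_maximal_def less_SUP_iff)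
  have r: "r > 0" using zr(1) by (auto intro: le_less_trans[OF zero_le_dist])
  have [measurable]: "h \<in> borel_measurable borel" unfolding h_def by measurable
  have [measurable]: "ball z r \<in> sets borel" by simp
  have "(\<integral>\<^sup>+y. ennreal (g y) * indicator (ball z r) y \<partial>lborel) \<le>
      (\<integral>\<^sup>+y. h y * indicator (ball z r) y + ennreal (s / (2 * ?V)) * indicator (ball z r) y \<partial>lborel)"
    using V s by (intro nn_integral_mono) (auto simp: h_def indicator_def field_simps intro!: ennreal_leI)
  also have "\<dots> = (\<integral>\<^sup>+y. h y * indicator (ball z r) y \<partial>lborel) + ennreal (s / (2 * ?V)) * emeasure lborel (ball z r)"
    by (simp add: nn_integral_add nn_integral_cmult_indicator)
  also have "ennreal (s / (2 * ?V)) * emeasure lborel (ball z r) = ennreal (s / 2 * r ^ DIM('a))"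
    using r s V0 by (simp add: emeasure_ball ennreal_mult'[symmetric])
  finally have "ball_avg (\<lambda>x. ennreal (g x)) z r \<le> ennreal (1 / r ^ DIM('a)) *
      ((\<integral>\<^sup>+y. h y * indicator (ball z r) y \<partial>lborel) + ennreal (s / 2 * r ^ DIM('a)))"
    unfolding ball_avg_def by (intro mult_left_mono) auto
  also have "\<dots> = ball_avg h z r + ennreal (s / 2)"
    using r s by (simp add: ball_avg_def distrib_left ennreal_mult'[symmetric])
  finally have "ennreal s < ball_avg h z r + ennreal (s / 2)" using zr(2) by (rule less_le_trans[rotated])
  moreover have "ennreal s = ennreal (s / 2) + ennreal (s / 2)" using s by (simp flip: ennreal_plus)
  ultimately have "ennreal (s / 2) < ball_avg h z r"
    by (metis add_right_mono leD leI)
  also have "\<dots> \<le> hl_maximal h x" unfolding hl_maximal_def using zr(1) by (intro SUP_upper2[of "(z, r)"]) auto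
  finally show ?thesis .
qed

text \<open>Marcinkiewicz interpolation: the layer-cake formula in \<open>s\<close>, the weak-type
  bound at level \<open>s / 2\<close> for the truncation depending on \<open>s\<close>, and Fubini.
  For fixed \<open>x\<close> there remains the integral of \<open>s powr (p - 2)\<close> up to
  \<open>2 * V * g x\<close>; it converges at 0 because \<open>p > 1\<close>, which is the source of
  the factor \<open>p / (p - 1)\<close>.\<close>

theorem hl_maximal_strong_type:
  fixes g :: "'a::euclidean_space \<Rightarrow> real"
  assumes [measurable]: "g \<in> borel_measurable borel" and g: "\<And>x. 0 \<le> g x" and p: "p > 1"
  defines "V \<equiv> unit_ball_vol DIM('a)"
  shows "(\<integral>\<^sup>+x. ennpow (hl_maximal (\<lambda>x. ennreal (g x)) x) p \<partial>lborel) \<le>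
    ennreal (2 * V * 5 ^ DIM('a) * (p / (p - 1)) * (2 * V) powr (p - 1)) * (\<integral>\<^sup>+x. ennreal (g x powr p) \<partial>lborel)"
proof -
  define K where "K = V * 5 ^ DIM('a)"
  have V: "V > 0" by (simp add: V_def)
  then have K: "K > 0" by (simp add: K_def)
  let ?m = "hl_maximal (\<lambda>x. ennreal (g x))"
  let ?h = "\<lambda>s x. if s < 2 * V * g x then ennreal (g x) else 0"
  have "(\<integral>\<^sup>+x. ennpow (?m x) p \<partial>lborel) \<le>
      (\<integral>\<^sup>+x. (\<integral>\<^sup>+s. ennreal (p * s powr (p - 1)) * indicator {s. 0 < s \<and> ennreal s < ?m x} s \<partial>lborel) \<partial>lborel)"
    using p by (intro nn_integral_mono ennpow_le_layer_cake) auto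
  also have "\<dots> = (\<integral>\<^sup>+s. (\<integral>\<^sup>+x. ennreal (p * s powr (p - 1)) * indicator {s. 0 < s \<and> ennreal s < ?m x} s \<partial>lborel) \<partial>lborel)"
    by (rule lborel_pair.Fubini') measurable
  also have "\<dots> \<le> (\<integral>\<^sup>+s. (\<integral>\<^sup>+x. ennreal (2 * K * p * s powr (p - 2)) * indicator {0<..} s * ?h s x \<partial>lborel) \<partial>lborel)"
  proof (rule nn_integral_mono)
    fix s :: real
    show "(\<integral>\<^sup>+x. ennreal (p * s powr (p - 1)) * indicator {s. 0 < s \<and> ennreal s < ?m x} s \<partial>lborel) \<le>
      (\<integral>\<^sup>+x. ennreal (2 * K * p * s powr (p - 2)) * indicator {0<..} s * ?h s x \<partial>lborel)"
    proof (cases "s > 0")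
      case True
      have "(\<integral>\<^sup>+x. ennreal (p * s powr (p - 1)) * indicator {s. 0 < s \<and> ennreal s < ?m x} s \<partial>lborel) =
          (\<integral>\<^sup>+x. ennreal (p * s powr (p - 1)) * indicator {x. ennreal s < ?m x} x \<partial>lborel)"
        using True by (intro nn_integral_cong) (auto simp: indicator_def)
      also have "\<dots> = ennreal (p * s powr (p - 1)) * emeasure lborel {x. ennreal s < ?m x}"
        by (rule nn_integral_cmult_indicator) measurable
      also have "\<dots> \<le> ennreal (p * s powr (p - 1)) * emeasure lborel {x. ennreal (s / 2) < hl_maximal (?h s) x}"
        using hl_maximal_truncate[OF assms(1) g True]
        by (intro mult_left_mono emeasure_mono) (auto simp: V_def)
      also have "\<dots> = ennreal (2 * p * s powr (p - 2)) * (ennreal (s / 2) * emeasure lborel {x. ennreal (s / 2) < hl_maximal (?h s) x})"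
      proof -
        have "s powr (p - 1) = s powr (p - 2) * s" using True powr_add[of s "p - 2" 1] by simp
        then have "ennreal (p * s powr (p - 1)) = ennreal (2 * p * s powr (p - 2)) * ennreal (s / 2)"
          using True p by (simp add: ennreal_mult'[symmetric])
        then show ?thesis by (simp add: mult.assoc)
      qed
      also have "\<dots> \<le> ennreal (2 * p * s powr (p - 2)) * (ennreal K * (\<integral>\<^sup>+x. ?h s x \<partial>lborel))"
        using True unfolding K_def V_def by (intro mult_left_mono hl_maximal_weak_type) auto
      also have "\<dots> = ennreal (2 * K * p * s powr (p - 2)) * (\<integral>\<^sup>+x. ?h s x \<partial>lborel)"
        using K p by (simp add: mult.assoc[symmetric] ennreal_mult'[symmetric]) (simp add: mult_ac)
      also have "\<dots> = (\<integral>\<^sup>+x. ennreal (2 * K * p * s powr (p - 2)) * indicator {0<..} s * ?h s x \<partial>lborel)"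
        using True by (subst nn_integral_cmult) auto
      finally show ?thesis .
    qed simp
  qed
  also have "\<dots> = (\<integral>\<^sup>+x. (\<integral>\<^sup>+s. ennreal (2 * K * p * s powr (p - 2)) * indicator {0<..} s * ?h s x \<partial>lborel) \<partial>lborel)"
    by (rule lborel_pair.Fubini') measurable
  also have "\<dots> = (\<integral>\<^sup>+x. ennreal (2 * K * (p / (p - 1)) * (2 * V) powr (p - 1)) * ennreal (g x powr p) \<partial>lborel)"
  proof (rule nn_integral_cong)
    fix x
    have "(\<integral>\<^sup>+s. ennreal (2 * K * p * s powr (p - 2)) * indicator {0<..} s * ?h s x \<partial>lborel) =
        (\<integral>\<^sup>+s. ennreal (2 * K * (p / (p - 1)) * g x) * (ennreal ((p - 1) * s powr (p - 1 - 1)) * indicator {0<..<2 * V * g x} s) \<partial>lborel)"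
    proof (rule nn_integral_cong)
      fix s
      have "p / (p - 1) * (p - 1) = p" using p by simp
      \<comment> \<open>Regrouped so that the \<open>s\<close>-dependent factor is the layer-cake
        density for the exponent \<open>p - 1\<close>.\<close>
      then have *: "2 * K * p * s powr (p - 2) * g x = 2 * K * (p / (p - 1)) * g x * ((p - 1) * s powr (p - 1 - 1))"
        by (simp add: mult.commute mult.left_commute del: times_divide_eq_left times_divide_eq_right)
      show "ennreal (2 * K * p * s powr (p - 2)) * indicator {0<..} s * ?h s x =
        ennreal (2 * K * (p / (p - 1)) * g x) * (ennreal ((p - 1) * s powr (p - 1 - 1)) * indicator {0<..<2 * V * g x} s)"
      proof (cases "0 < s \<and> s < 2 * V * g x")
        case True
        then show ?thesis using arg_cong[OF *, of ennreal] K p g[of x] by (simp add: ennreal_mult'[symmetric])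
      qed (auto simp: indicator_def)
    qed
    also have "\<dots> = ennreal (2 * K * (p / (p - 1)) * g x) * ennreal ((2 * V * g x) powr (p - 1))"
    proof -
      have lc: "(\<integral>\<^sup>+s. ennreal ((p - 1) * s powr (p - 1 - 1)) * indicator {0<..<2 * V * g x} s \<partial>lborel) =
          ennreal ((2 * V * g x) powr (p - 1))"
        using p g[of x] V by (intro nn_integral_layer_cake_real) auto
      show ?thesis unfolding lc[symmetric] by (rule nn_integral_cmult) measurable
    qed
    also have "\<dots> = ennreal (2 * K * (p / (p - 1)) * (2 * V) powr (p - 1)) * ennreal (g x powr p)"
    proof -
      have "g x * g x powr (p - 1) = g x powr p"
        using g[of x] p powr_add[of "g x" 1 "p - 1"] by (cases "g x = 0") auto
      then have "2 * K * (p / (p - 1)) * g x * (2 * V * g x) powr (p - 1) = 2 * K * (p / (p - 1)) * (2 * V) powr (p - 1) * g x powr p"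
        using g[of x] V by (simp add: powr_mult)
      then show ?thesis using K p g[of x] by (simp flip: ennreal_mult')
    qed
    finally show "(\<integral>\<^sup>+s. ennreal (2 * K * p * s powr (p - 2)) * indicator {0<..} s * ?h s x \<partial>lborel) = \<dots>" .
  qed
  also have "\<dots> = ennreal (2 * K * (p / (p - 1)) * (2 * V) powr (p - 1)) * (\<integral>\<^sup>+x. ennreal (g x powr p) \<partial>lborel)"
    by (rule nn_integral_cmult) measurable
  finally show ?thesis by (simp add: K_def mult.assoc)
qed

section \<open>Gaussian averages dominated by the maximal function\<close>

lemma power_div_fact_le_exp:
  fixes u :: real
  assumes "0 \<le> u"
  shows "u ^ n / fact n \<le> exp u"
proof -
  have "(\<Sum>m\<in>{n}. u ^ m /\<^sub>R fact m) \<le> (\<Sum>m. u ^ m /\<^sub>R fact m)"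
    using assms by (intro sum_le_suminf summable_exp_generic) auto
  also have "\<dots> = exp u" by (rule sums_unique[OF exp_converges, symmetric])
  finally show ?thesis by (simp add: divide_inverse mult.commute)
qed

lemma power_exp_summable:
  assumes d: "d > 0"
  shows "summable (\<lambda>k. real (Suc k) ^ n * exp (- d * (real k)\<^sup>2))"
proof (rule summable_comparison_test')
  show "summable (\<lambda>k. fact n * (2 / d) ^ n * exp (d / 2) * exp (- (d / 2)) ^ k)"
    using d by (intro summable_mult summable_geometric) simp
  fix k :: nat
  \<comment> \<open>Half of the decay absorbs the polynomial: \<open>(k + 1)^n\<close> costs at most
    a constant times \<open>exp ?u\<close>, while \<open>k^2 \<ge> k\<close> gives decay at rate
    \<open>d\<close>. The rest is geometric with ratio \<open>exp (- (d / 2))\<close>.\<close>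
  let ?u = "d / 2 * real (Suc k)"
  have u: "?u ^ n / fact n \<le> exp ?u" using d by (intro power_div_fact_le_exp) auto
  have "real (Suc k) ^ n \<le> fact n * (2 / d) ^ n * exp ?u"
  proof -
    have "real (Suc k) ^ n = fact n * (2 / d) ^ n * (?u ^ n / fact n)"
      using d by (simp add: power_mult_distrib[symmetric] del: of_nat_Suc)
    also have "\<dots> \<le> fact n * (2 / d) ^ n * exp ?u"
      using u d by (intro mult_left_mono) auto
    finally show ?thesis .
  qed
  moreover have "real k \<le> (real k)\<^sup>2" by (cases k) (auto simp: power2_eq_square)
  then have "exp (- d * (real k)\<^sup>2) \<le> exp (- d * real k)" using d by simp
  ultimately have "real (Suc k) ^ n * exp (- d * (real k)\<^sup>2) \<le> (fact n * (2 / d) ^ n * exp ?u) * exp (- d * real k)"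
    using d by (intro mult_mono) auto
  also have "\<dots> = fact n * (2 / d) ^ n * exp (d / 2) * exp (- (d / 2)) ^ k"
  proof -
    have "exp ?u * exp (- d * real k) = exp (d / 2) * exp (- (d / 2) * real k)"
      by (simp add: field_simps flip: exp_add)
    moreover have "exp (- (d / 2) * real k) = exp (- (d / 2)) ^ k"
      by (simp add: exp_of_nat_mult[symmetric] mult.commute)
    ultimately show ?thesis by (simp only: mult.assoc)
  qed
  finally show "norm (real (Suc k) ^ n * exp (- d * (real k)\<^sup>2)) \<le> fact n * (2 / d) ^ n * exp (d / 2) * exp (- (d / 2)) ^ k"
    by (simp add: abs_mult)
qed

text \<open>Cut space into shells of width \<open>sqrt s\<close> around \<open>x\<close>. On the
  \<open>k\<close>-th shell the exponential is at most \<open>a k\<close>, and the shell lies in the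
  ball of radius \<open>(k + 1) * sqrt s\<close>; normalising by that ball costs
  \<open>(k + 1) ^ n\<close>, independently of \<open>s\<close>.\<close>

lemma gaussian_mean_le_hl_maximal:
  fixes g :: "'a::euclidean_space \<Rightarrow> ennreal"
  assumes d: "d > 0" and [measurable]: "g \<in> borel_measurable borel" and s: "s > 0"
  shows "(\<integral>\<^sup>+y. ennreal (exp (- d * (norm (x - y))\<^sup>2 / s) / sqrt s ^ DIM('a)) * g y \<partial>lborel) \<le>
    ennreal (\<Sum>k. real (Suc k) ^ DIM('a) * exp (- d * (real k)\<^sup>2)) * hl_maximal g x"
proof -
  define n where "n = DIM('a)"
  define r where "r k = real (Suc k) * sqrt s" for k
  define a where "a k = exp (- d * (real k)\<^sup>2)" for k
  have r: "r k > 0" for k using s by (simp add: r_def)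
  have [measurable]: "ball x (r k) \<in> sets borel" for k by simp
  have "(\<integral>\<^sup>+y. ennreal (exp (- d * (norm (x - y))\<^sup>2 / s) / sqrt s ^ n) * g y \<partial>lborel) \<le>
      (\<integral>\<^sup>+y. (\<Sum>k. ennreal (a k / sqrt s ^ n) * (g y * indicator (ball x (r k)) y)) \<partial>lborel)"
  proof (rule nn_integral_mono)
    fix y
    define k where "k = nat \<lfloor>norm (x - y) / sqrt s\<rfloor>"
    have "real k \<le> norm (x - y) / sqrt s" "norm (x - y) / sqrt s < real (Suc k)"
      using s by (simp_all add: k_def) linarith
    then have k: "real k * sqrt s \<le> norm (x - y)" "norm (x - y) < r k"
      using s by (auto simp: r_def field_simps)
    have "(real k)\<^sup>2 * s \<le> (norm (x - y))\<^sup>2"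
      using power_mono[OF k(1), of 2] s by (simp add: power_mult_distrib)
    then have "d * (real k)\<^sup>2 \<le> d * (norm (x - y))\<^sup>2 / s" using s d by (simp add: field_simps)
    then have "exp (- d * (norm (x - y))\<^sup>2 / s) / sqrt s ^ n \<le> a k / sqrt s ^ n"
      using s by (intro divide_right_mono) (auto simp: a_def)
    then have "ennreal (exp (- d * (norm (x - y))\<^sup>2 / s) / sqrt s ^ n) * g y \<le> ennreal (a k / sqrt s ^ n) * (g y * indicator (ball x (r k)) y)"
      using k(2) by (simp add: dist_norm mult_right_mono ennreal_leI)
    also have "\<dots> = (\<Sum>j\<in>{k}. ennreal (a j / sqrt s ^ n) * (g y * indicator (ball x (r j)) y))" by simp
    also have "\<dots> \<le> (\<Sum>k. ennreal (a k / sqrt s ^ n) * (g y * indicator (ball x (r k)) y))"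
      by (intro sum_le_suminf) auto
    finally show "ennreal (exp (- d * (norm (x - y))\<^sup>2 / s) / sqrt s ^ n) * g y \<le> \<dots>" .
  qed
  also have "\<dots> = (\<Sum>k. \<integral>\<^sup>+y. ennreal (a k / sqrt s ^ n) * (g y * indicator (ball x (r k)) y) \<partial>lborel)"
    by (rule nn_integral_suminf) measurable
  also have "\<dots> = (\<Sum>k. ennreal (a k / sqrt s ^ n) * (\<integral>\<^sup>+y. g y * indicator (ball x (r k)) y \<partial>lborel))"
    by (subst nn_integral_cmult) auto
  also have "\<dots> \<le> (\<Sum>k. ennreal (real (Suc k) ^ n * a k) * hl_maximal g x)"
  proof (intro suminf_le)
    fix k
    have "ennreal (a k / sqrt s ^ n) = ennreal (real (Suc k) ^ n * a k) * ennreal (1 / r k ^ n)"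
    proof -
      have "r k ^ n = real (Suc k) ^ n * sqrt s ^ n" by (simp only: r_def power_mult_distrib)
      then have "a k / sqrt s ^ n = (real (Suc k) ^ n * a k) * (1 / r k ^ n)"
        by (simp del: of_nat_Suc)
      moreover have "0 \<le> real (Suc k) ^ n * a k" by (simp add: a_def)
      ultimately show ?thesis by (simp only: ennreal_mult')
    qed
    then have "ennreal (a k / sqrt s ^ n) * (\<integral>\<^sup>+y. g y * indicator (ball x (r k)) y \<partial>lborel) =
        ennreal (real (Suc k) ^ n * a k) * ball_avg g x (r k)"
      by (simp add: ball_avg_def n_def mult.assoc)
    also have "\<dots> \<le> ennreal (real (Suc k) ^ n * a k) * hl_maximal g x"
      unfolding hl_maximal_def using r by (intro mult_left_mono SUP_upper2[of "(x, r k)"]) auto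
    finally show "ennreal (a k / sqrt s ^ n) * (\<integral>\<^sup>+y. g y * indicator (ball x (r k)) y \<partial>lborel) \<le> \<dots>" .
  qed auto
  also have "\<dots> = (\<Sum>k. ennreal (real (Suc k) ^ n * a k)) * hl_maximal g x"
    by (rule ennreal_suminf_multc)
  also have "(\<Sum>k. ennreal (real (Suc k) ^ n * a k)) = ennreal (\<Sum>k. real (Suc k) ^ n * a k)"
    using power_exp_summable[OF d, of n] by (intro suminf_ennreal2) (auto simp: a_def)
  finally show ?thesis by (simp add: n_def a_def)
qed

section \<open>The maximal operator\<close>

text \<open>The previous domination applied to the constant function 1, whose maximal function is at
  most the unit ball volume.\<close>

lemma gaussian_mass_bound:
  assumes d: "d > 0"
  obtains C where "C > 0"
    "\<And>s x :: 'a::euclidean_space. s > 0 \<Longrightarrow>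
      (\<integral>\<^sup>+y. ennreal (exp (- d * (norm (x - y))\<^sup>2 / s) / sqrt s ^ DIM('a)) \<partial>lborel) \<le> ennreal C"
proof -
  let ?V = "unit_ball_vol DIM('a)"
  let ?A = "\<Sum>k. real (Suc k) ^ DIM('a) * exp (- d * (real k)\<^sup>2)"
  have V: "?V > 0" by simp
  have A: "?A \<ge> 0" using power_exp_summable[OF d] by (intro suminf_nonneg) auto
  have "hl_maximal (\<lambda>_. 1) x \<le> ennreal ?V" for x :: 'a
    unfolding hl_maximal_def
  proof (rule SUP_least, clarify)
    fix z :: 'a and r assume "x \<in> ball z r"
    then have r: "r > 0" by (metis mem_ball order.strict_trans1 zero_le_dist)
    have [measurable]: "ball z r \<in> sets borel" by simp
    have "ball_avg (\<lambda>_. 1) z r = ennreal (1 / r ^ DIM('a)) * ennreal (?V * r ^ DIM('a))"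
      using r by (simp add: ball_avg_def emeasure_ball)
    also have "\<dots> = ennreal ?V" using r by (simp flip: ennreal_mult')
    finally show "ball_avg (\<lambda>_. 1) z r \<le> ennreal ?V" by simp
  qed
  then have hl: "hl_maximal (\<lambda>_. 1) x \<le> ennreal ?V" for x :: 'a .
  have *: "ennreal ?A * hl_maximal (\<lambda>_. 1) x \<le> ennreal (?A * ?V + 1)" for x :: 'a
  proof -
    have "ennreal ?A * hl_maximal (\<lambda>_. 1) x \<le> ennreal ?A * ennreal ?V"
      by (intro mult_left_mono hl) simp
    also have "\<dots> = ennreal (?A * ?V)" by (rule ennreal_mult'[OF A, symmetric])
    also have "\<dots> \<le> ennreal (?A * ?V + 1)" by (intro ennreal_leI) simp
    finally show ?thesis .
  qed
  show ?thesis
  proof (rule that)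
    show "?A * ?V + 1 > 0" using A V by (intro add_nonneg_pos mult_nonneg_nonneg) auto
    fix s and x :: 'a assume "s > (0 :: real)"
    from order_trans[OF gaussian_mean_le_hl_maximal[OF d _ this, of "\<lambda>_. 1" x] *]
    show "(\<integral>\<^sup>+y. ennreal (exp (- d * (norm (x - y))\<^sup>2 / s) / sqrt s ^ DIM('a)) \<partial>lborel) \<le> ennreal (?A * ?V + 1)"
      by simp
  qed
qed

section \<open>The measure \<gamma>, and regularity of the semigroup in time and space\<close>

context ou_data
begin

abbreviation \<gamma> :: "(real^'n) measure" where "\<gamma> \<equiv> ou_gauss Q B \<infinity>"

definition gauss_const :: real where
  "gauss_const = (2 * pi) powr (- real CARD('n) / 2) * det S powr (- 1 / 2)"

text \<open>\<open>powr\<close> with a nonzero base is an exponential, so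
  \<open>det S \<noteq> 0\<close> suffices.\<close>

lemma gauss_const_pos: "gauss_const > 0"
  using det_S_nonzero by (simp add: gauss_const_def)

lemma gauss_eq: "\<gamma> = density lborel (\<lambda>y. ennreal (gauss_const * exp (- R y)))"
  by (simp add: ou_gauss_def gauss_const_def ou_R_def)

lemma sets_gauss [measurable_cong, simp]: "sets \<gamma> = sets borel"
  by (simp add: gauss_eq)

lemma space_gauss [simp]: "space \<gamma> = UNIV"
  by (simp add: gauss_eq)

lemma continuous_on_R: "continuous_on A R"
  unfolding ou_R_def
  by (intro continuous_intros bounded_bilinear.continuous_on[OF bounded_bilinear_matrix_vector_mult])

lemma R_measurable [measurable]: "R \<in> borel_measurable borel"
  by (rule borel_measurable_continuous_onI[OF continuous_on_R])

lemma mehler_measurable [measurable]: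
  "(\<lambda>(x, u). mehler_kernel Q B t x u) \<in> borel_measurable (borel \<Otimes>\<^sub>M borel)"
  unfolding borel_prod by (rule borel_measurable_continuous_onI[OF continuous_on_mehler_space])

lemma mehler_measurable_snd [measurable]: "mehler_kernel Q B t x \<in> borel_measurable borel"
  using measurable_compose_Pair1[OF _ mehler_measurable, of x t] by simp

lemma nn_integral_gauss:
  assumes [measurable]: "f \<in> borel_measurable borel"
  shows "(\<integral>\<^sup>+x. f x \<partial>\<gamma>) = (\<integral>\<^sup>+x. ennreal (gauss_const * exp (- R x)) * f x \<partial>lborel)"
  unfolding gauss_eq by (rule nn_integral_density) measurable

lemma finite_gauss: "finite_measure \<gamma>"
proof (rule finite_measureI)
  obtain c C where c: "c > 0" "C > 0" "coercive_matrix S c" "\<And>x. (S *v x) \<bullet> x \<le> C * (norm x)\<^sup>2"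
    using coercive_cov by metis
  have Rlow: "1 / (2 * C) * (norm x)\<^sup>2 \<le> R x" for x
    using coercive_matrix.inv_lower[OF c(3,2,4), of x] by (simp add: ou_R_def)
  obtain K where K: "\<And>s x :: real^'n. s > 0 \<Longrightarrow>
      (\<integral>\<^sup>+y. ennreal (exp (- (1 / (2 * C)) * (norm (x - y))\<^sup>2 / s) / sqrt s ^ DIM(real^'n)) \<partial>lborel) \<le> ennreal K"
    using gaussian_mass_bound[where 'a = "real^'n", of "1 / (2 * C)"] c by (metis divide_pos_pos mult_pos_pos zero_less_numeral zero_less_one)
  have "emeasure \<gamma> UNIV = (\<integral>\<^sup>+x. 1 \<partial>\<gamma>)" by simp
  also have "\<dots> = (\<integral>\<^sup>+x. ennreal gauss_const * ennreal (exp (- R x)) \<partial>lborel)"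
    using gauss_const_pos by (subst nn_integral_gauss) (auto simp: ennreal_mult')
  also have "\<dots> \<le> (\<integral>\<^sup>+(x :: real^'n). ennreal gauss_const * ennreal (exp (- (1 / (2 * C)) * (norm x)\<^sup>2)) \<partial>lborel)"
  proof (rule nn_integral_mono)
    fix x :: "real^'n"
    have "exp (- R x) \<le> exp (- (1 / (2 * C)) * (norm x)\<^sup>2)" using Rlow[of x] by simp
    then show "ennreal gauss_const * ennreal (exp (- R x)) \<le>
        ennreal gauss_const * ennreal (exp (- (1 / (2 * C)) * (norm x)\<^sup>2))"
      by (intro mult_left_mono ennreal_leI) simp_all
  qed
  also have "\<dots> = ennreal gauss_const * (\<integral>\<^sup>+(x :: real^'n). ennreal (exp (- (1 / (2 * C)) * (norm x)\<^sup>2)) \<partial>lborel)"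
    by (rule nn_integral_cmult) measurable
  also have "\<dots> \<le> ennreal gauss_const * ennreal K"
    using K[of 1 0] by (intro mult_left_mono) auto
  finally show "emeasure \<gamma> (space \<gamma>) \<noteq> \<infinity>"
    using gauss_const_pos by (simp add: ennreal_mult'[symmetric] top_unique)
      (metis ennreal_neq_top infinity_ennreal_def neq_top_trans)
qed

lemma norm_semigroup_le:
  assumes [measurable]: "f \<in> borel_measurable borel"
  shows "ennreal (norm (ou_semigroup Q B t f x)) \<le>
    (\<integral>\<^sup>+u. ennreal (gauss_const * (\<bar>mehler_kernel Q B t x u\<bar> * exp (- R u))) * ennreal (norm (f u)) \<partial>lborel)"
proof -
  have "ennreal (norm (ou_semigroup Q B t f x)) \<le> (\<integral>\<^sup>+u. ennreal (norm (mehler_kernel Q B t x u *\<^sub>R f u)) \<partial>\<gamma>)"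
  proof (cases "integrable \<gamma> (\<lambda>u. mehler_kernel Q B t x u *\<^sub>R f u)")
    case True
    then show ?thesis unfolding ou_semigroup_def by (rule integral_norm_bound_ennreal)
  next
    \<comment> \<open>The Bochner integral of a non-integrable function is 0 by convention, so the
      bound is trivial here.\<close>
    case False
    then show ?thesis unfolding ou_semigroup_def by (simp add: not_integrable_integral_eq)
  qed
  also have "\<dots> = (\<integral>\<^sup>+u. ennreal (gauss_const * exp (- R u)) * ennreal (norm (mehler_kernel Q B t x u *\<^sub>R f u)) \<partial>lborel)"
    by (rule nn_integral_gauss) measurable
  also have "\<dots> = (\<integral>\<^sup>+u. ennreal (gauss_const * (\<bar>mehler_kernel Q B t x u\<bar> * exp (- R u))) * ennreal (norm (f u)) \<partial>lborel)"
    using gauss_const_pos by (intro nn_integral_cong) (simp add: ennreal_mult'[symmetric] mult_ac)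
  finally show ?thesis .
qed

text \<open>Dominated convergence. The majorant blows up as \<open>t\<close> tends to 0, so the
  argument runs on \<open>{e<..}\<close> and the open half-lines are then united.\<close>

lemma semigroup_continuous_time:
  assumes f: "integrable \<gamma> f"
  shows "continuous_on {0<..} (\<lambda>t. ou_semigroup Q B t f x)"
proof -
  obtain C where C: "C > 0" "\<And>t x y. t > 0 \<Longrightarrow> \<bar>mehler_kernel Q B t x y\<bar> \<le> C / sqrt (min 1 t) ^ CARD('n) * exp (R x)"
    using mehler_kernel_le by metis
  have [measurable]: "f \<in> borel_measurable borel" using borel_measurable_integrable[OF f] by simp
  have "continuous_on {e<..} (\<lambda>t. ou_semigroup Q B t f x)" if e: "e > 0" for e
    unfolding continuous_on_sequentially
  proof (intro allI ballI impI, elim conjE)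
    fix X :: "nat \<Rightarrow> real" and t assume t: "t \<in> {e<..}" and X: "\<forall>k. X k \<in> {e<..}" "X \<longlonglongrightarrow> t"
    have "(\<lambda>k. ou_semigroup Q B (X k) f x) \<longlonglongrightarrow> ou_semigroup Q B t f x"
      unfolding ou_semigroup_def
    proof (rule integral_dominated_convergence)
      show "integrable \<gamma> (\<lambda>u. C / sqrt (min 1 e) ^ CARD('n) * exp (R x) * norm (f u))"
        using f by simp
      show "AE u in \<gamma>. (\<lambda>k. mehler_kernel Q B (X k) x u *\<^sub>R f u) \<longlonglongrightarrow> mehler_kernel Q B t x u *\<^sub>R f u"
      proof (rule AE_I2)
        fix u
        have "(\<lambda>k. mehler_kernel Q B (X k) x u) \<longlonglongrightarrow> mehler_kernel Q B t x u"
        proof (rule continuous_on_tendsto_compose[OF continuous_on_mehler_time X(2)])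
          show "\<forall>\<^sub>F k in sequentially. X k \<in> {0<..}"
            using X(1) e by (intro always_eventually) (auto intro: less_trans[OF e])
        qed (use t e in auto)
        then show "(\<lambda>k. mehler_kernel Q B (X k) x u *\<^sub>R f u) \<longlonglongrightarrow> mehler_kernel Q B t x u *\<^sub>R f u"
          by (intro tendsto_intros)
      qed
      fix k
      show "AE u in \<gamma>. norm (mehler_kernel Q B (X k) x u *\<^sub>R f u) \<le> C / sqrt (min 1 e) ^ CARD('n) * exp (R x) * norm (f u)"
      proof (rule AE_I2)
        fix u
        have Xk: "e < X k" using X(1) by auto
        have "\<bar>mehler_kernel Q B (X k) x u\<bar> \<le> C / sqrt (min 1 (X k)) ^ CARD('n) * exp (R x)"
          using Xk e by (intro C(2)) auto
        also have "\<dots> \<le> C / sqrt (min 1 e) ^ CARD('n) * exp (R x)"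
          using Xk e C(1) by (intro mult_right_mono divide_left_mono power_mono mult_pos_pos zero_less_power) auto
        finally have "\<bar>mehler_kernel Q B (X k) x u\<bar> \<le> C / sqrt (min 1 e) ^ CARD('n) * exp (R x)" .
        from mult_right_mono[OF this norm_ge_zero[of "f u"]]
        show "norm (mehler_kernel Q B (X k) x u *\<^sub>R f u) \<le> C / sqrt (min 1 e) ^ CARD('n) * exp (R x) * norm (f u)"
          by (simp only: norm_scaleR)
      qed
    qed measurable
    then show "((\<lambda>t. ou_semigroup Q B t f x) \<circ> X) \<longlonglongrightarrow> ou_semigroup Q B t f x" by (simp add: o_def)
  qed
  then have "continuous_on (\<Union>e\<in>{0<..}. {e<..}) (\<lambda>t. ou_semigroup Q B t f x)"
    by (intro continuous_on_open_UN) auto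
  moreover have "(\<Union>e\<in>{0<..}. {e<..}) = ({0<..} :: real set)" using dense[of "0 :: real"] by auto
  ultimately show ?thesis by simp
qed

lemma semigroup_measurable:
  assumes [measurable]: "f \<in> borel_measurable borel"
  shows "ou_semigroup Q B t f \<in> borel_measurable borel"
proof -
  interpret finite_measure \<gamma> by (rule finite_gauss)
  show ?thesis unfolding ou_semigroup_def by measurable
qed

text \<open>A time at which \<open>h\<close> exceeded the rational supremum would have a
  neighbourhood with the same property, and that contains a rational. This makes the supremum over
  times countable, hence measurable.\<close>

lemma SUP_rational_times:
  fixes h :: "real \<Rightarrow> ennreal"
  assumes h: "continuous_on {0<..} h"
  shows "(SUP t\<in>{0<..}. h t) = (SUP t\<in>{0<..} \<inter> \<rat>. h t)"
proof (rule antisym)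
  show "(SUP t\<in>{0<..}. h t) \<le> (SUP t\<in>{0<..} \<inter> \<rat>. h t)"
  proof (rule SUP_least, rule ccontr)
    fix t :: real assume t: "t \<in> {0<..}"
    let ?s = "SUP t\<in>{0<..} \<inter> \<rat>. h t"
    assume "\<not> h t \<le> ?s"
    then have "t \<in> h -` {?s<..} \<inter> {0<..}" using t by auto
    moreover have "open (h -` {?s<..} \<inter> {0<..})"
      using h by (intro continuous_on_open_vimage[THEN iffD1, rule_format]) auto
    ultimately obtain e where e: "e > 0" "ball t e \<subseteq> h -` {?s<..} \<inter> {0<..}"
      by (meson open_contains_ball)
    obtain q where q: "q \<in> \<rat>" "t < q" "q < t + e" using Rats_dense_in_real[of t "t + e"] e by auto
    then have "q \<in> ball t e" by (simp add: dist_real_def)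
    then have "q \<in> h -` {?s<..} \<inter> {0<..}" using e(2) by blast
    then have "?s < h q" "q \<in> {0<..} \<inter> \<rat>" using q by auto
    then show False using SUP_upper[of q "{0<..} \<inter> \<rat>" h] by (simp add: leD)
  qed
qed (intro SUP_subset_mono, auto)

lemma maximal_measurable:
  assumes f: "integrable \<gamma> f"
  shows "ou_maximal Q B f \<in> borel_measurable \<gamma>"
proof -
  have m: "f \<in> borel_measurable borel" using borel_measurable_integrable[OF f] by simp
  have "ou_maximal Q B f x = (SUP t\<in>{0<..} \<inter> \<rat>. ennreal (norm (ou_semigroup Q B t f x)))" for x
    unfolding ou_maximal_def
    by (intro SUP_rational_times continuous_on_ennreal continuous_on_norm semigroup_continuous_time f)
  then have "ou_maximal Q B f = (\<lambda>x. SUP t\<in>{0<..} \<inter> \<rat>. ennreal (norm (ou_semigroup Q B t f x)))" by auto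
  moreover have "(\<lambda>x. SUP t\<in>{0<..} \<inter> \<rat>. ennreal (norm (ou_semigroup Q B t f x))) \<in> borel_measurable borel"
    using semigroup_measurable[OF m]
    by (intro borel_measurable_SUP countable_Int2 countable_rat) measurable
  ultimately show ?thesis by simp
qed

text \<open>The weight \<open>exp (R / q)\<close> is moved to the outside at \<open>x\<close> and
  its inverse onto \<open>f\<close>, leaving the conjugated kernel with its Gaussian bound. The
  right-hand side is independent of \<open>t\<close>, so it bounds the supremum.\<close>

lemma maximal_pointwise_le:
  assumes q: "q > 1"
  obtains K where "K > 0"
    "\<And>f x. f \<in> borel_measurable borel \<Longrightarrow>
      ou_maximal Q B f x \<le> ennreal (K * exp (R x / q)) * hl_maximal (\<lambda>u. ennreal (norm (f u) * exp (- R u / q))) x"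
proof -
  obtain C d where C: "C > 0" and d: "d > 0" and ker:
    "\<And>t x y. t > 0 \<Longrightarrow> \<bar>mehler_kernel Q B t x y\<bar> * exp (- R y) * exp (1 / q * (R y - R x)) \<le>
       C / sqrt (min 1 t) ^ CARD('n) * exp (- d * (norm (x - y))\<^sup>2 / min 1 t)"
    using mehler_conjugated_le[of "1 / q"] q by auto
  define A where "A = (\<Sum>k. real (Suc k) ^ CARD('n) * exp (- d * (real k)\<^sup>2))"
  have A: "A \<ge> 0" unfolding A_def using power_exp_summable[OF d] by (intro suminf_nonneg) auto
  define K where "K = gauss_const * C * (A + 1)"
  have "ou_maximal Q B f x \<le> ennreal (K * exp (R x / q)) * hl_maximal (\<lambda>u. ennreal (norm (f u) * exp (- R u / q))) x"
    if [measurable]: "f \<in> borel_measurable borel" for f x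
    unfolding ou_maximal_def
  proof (rule SUP_least)
    fix t :: real assume "t \<in> {0<..}"
    then have t: "t > 0" by simp
    let ?s = "min 1 t"
    let ?g = "\<lambda>u. ennreal (norm (f u) * exp (- R u / q))"
    let ?G = "\<lambda>u. exp (- d * (norm (x - u))\<^sup>2 / ?s) / sqrt ?s ^ DIM(real^'n)"
    have "ennreal (norm (ou_semigroup Q B t f x)) \<le>
      (\<integral>\<^sup>+u. ennreal (gauss_const * (\<bar>mehler_kernel Q B t x u\<bar> * exp (- R u))) * ennreal (norm (f u)) \<partial>lborel)"
      by (rule norm_semigroup_le) measurable
    also have "\<dots> \<le> (\<integral>\<^sup>+u. ennreal (gauss_const * C * exp (R x / q)) * (ennreal (?G u) * ?g u) \<partial>lborel)"
    proof (rule nn_integral_mono)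
      fix u
      \<comment> \<open>These factors cancel; inserting their product exposes the conjugated
        kernel.\<close>
      have "exp (1 / q * (R u - R x)) * exp (R x / q) * exp (- R u / q) = 1"
        by (simp add: diff_divide_distrib flip: exp_add)
      then have "\<bar>mehler_kernel Q B t x u\<bar> * exp (- R u) =
          (\<bar>mehler_kernel Q B t x u\<bar> * exp (- R u) * exp (1 / q * (R u - R x))) * (exp (R x / q) * exp (- R u / q))"
        by (simp only: mult.assoc mult_1_right)
      also have "\<dots> \<le> (C / sqrt ?s ^ CARD('n) * exp (- d * (norm (x - u))\<^sup>2 / ?s)) * (exp (R x / q) * exp (- R u / q))"
        by (intro mult_right_mono ker t) auto
      finally have "gauss_const * (\<bar>mehler_kernel Q B t x u\<bar> * exp (- R u)) * norm (f u) \<le>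
          gauss_const * ((C / sqrt ?s ^ CARD('n) * exp (- d * (norm (x - u))\<^sup>2 / ?s)) * (exp (R x / q) * exp (- R u / q))) * norm (f u)"
        using gauss_const_pos by (intro mult_right_mono mult_left_mono) auto
      also have "\<dots> = (gauss_const * C * exp (R x / q)) * (?G u * (norm (f u) * exp (- R u / q)))"
        by simp
      finally show "ennreal (gauss_const * (\<bar>mehler_kernel Q B t x u\<bar> * exp (- R u))) * ennreal (norm (f u)) \<le>
          ennreal (gauss_const * C * exp (R x / q)) * (ennreal (?G u) * ?g u)"
        using gauss_const_pos C t by (simp add: ennreal_mult'[symmetric] ennreal_leI)
    qed
    also have "\<dots> = ennreal (gauss_const * C * exp (R x / q)) * (\<integral>\<^sup>+u. ennreal (?G u) * ?g u \<partial>lborel)"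
      by (rule nn_integral_cmult) measurable
    also have "\<dots> \<le> ennreal (gauss_const * C * exp (R x / q)) * (ennreal A * hl_maximal ?g x)"
      using gaussian_mean_le_hl_maximal[OF d, of ?g ?s x] t
      by (intro mult_left_mono) (auto simp: A_def)
    also have "\<dots> = ennreal (gauss_const * C * exp (R x / q) * A) * hl_maximal ?g x"
      using gauss_const_pos C A by (simp add: ennreal_mult' mult.assoc)
    also have "\<dots> \<le> ennreal (K * exp (R x / q)) * hl_maximal ?g x"
      using gauss_const_pos C A by (intro mult_right_mono ennreal_leI) (auto simp: K_def algebra_simps)
    finally show "ennreal (norm (ou_semigroup Q B t f x)) \<le> ennreal (K * exp (R x / q)) * hl_maximal ?g x" .
  qed
  moreover have "K > 0" using gauss_const_pos C A by (simp add: K_def)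
  ultimately show ?thesis using that by blast
qed

text \<open>The \<open>q\<close>-th power of the outer weight is \<open>exp (R x)\<close>, which
  cancels the density of \<gamma>; on the right, \<open>g powr q\<close> is
  \<open>norm f powr q\<close> times \<open>exp (- R)\<close>, which restores that density. Thus the
  Lebesgue strong-type bound becomes a bound for \<gamma>.\<close>

lemma maximal_Lq_bound:
  assumes q: "q > 1"
  obtains Z where "Z > 0"
    "\<And>f. integrable \<gamma> f \<Longrightarrow>
      (\<integral>\<^sup>+x. ennpow (ou_maximal Q B f x) q \<partial>\<gamma>) \<le> ennreal Z * (\<integral>\<^sup>+x. ennpow (ennreal (norm (f x))) q \<partial>\<gamma>)"
proof -
  obtain K where K: "K > 0" and pt:
    "\<And>f x. f \<in> borel_measurable borel \<Longrightarrow>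
      ou_maximal Q B f x \<le> ennreal (K * exp (R x / q)) * hl_maximal (\<lambda>u. ennreal (norm (f u) * exp (- R u / q))) x"
    using maximal_pointwise_le[OF q] by blast
  define V where "V = unit_ball_vol DIM(real^'n)"
  have V: "V > 0" unfolding V_def by simp
  define H where "H = 2 * V * 5 ^ DIM(real^'n) * (q / (q - 1)) * (2 * V) powr (q - 1)"
  have H: "H > 0" using q V unfolding H_def by (intro mult_pos_pos) auto
  have "(\<integral>\<^sup>+x. ennpow (ou_maximal Q B f x) q \<partial>\<gamma>) \<le> ennreal (K powr q * H) * (\<integral>\<^sup>+x. ennpow (ennreal (norm (f x))) q \<partial>\<gamma>)"
    if f: "integrable \<gamma> f" for f
  proof -
    have [measurable]: "f \<in> borel_measurable borel" using borel_measurable_integrable[OF f] by simp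
    have [measurable]: "ou_maximal Q B f \<in> borel_measurable borel" using maximal_measurable[OF f] by simp
    define g where "g u = norm (f u) * exp (- R u / q)" for u
    have g[measurable]: "g \<in> borel_measurable borel" and g0: "g u \<ge> 0" for u
      by (simp_all add: g_def[abs_def])
    have [measurable]: "(\<lambda>a. ennpow a q) \<in> borel_measurable borel"
      unfolding ennpow_def by measurable
    have "(\<integral>\<^sup>+x. ennpow (ou_maximal Q B f x) q \<partial>\<gamma>) =
        (\<integral>\<^sup>+x. ennreal (gauss_const * exp (- R x)) * ennpow (ou_maximal Q B f x) q \<partial>lborel)"
      by (rule nn_integral_gauss) measurable
    also have "\<dots> \<le> (\<integral>\<^sup>+x. ennreal (gauss_const * K powr q) * ennpow (hl_maximal (\<lambda>u. ennreal (g u)) x) q \<partial>lborel)"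
    proof (rule nn_integral_mono)
      fix x
      let ?h = "hl_maximal (\<lambda>u. ennreal (g u)) x"
      have "ou_maximal Q B f x \<le> ennreal (K * exp (R x / q)) * ?h" unfolding g_def by (rule pt) measurable
      then have "ennpow (ou_maximal Q B f x) q \<le> ennpow (ennreal (K * exp (R x / q)) * ?h) q"
        using q by (intro ennpow_mono) auto
      also have "\<dots> = ennreal ((K * exp (R x / q)) powr q) * ennpow ?h q"
        using K q by (intro ennpow_mult) auto
      also have "(K * exp (R x / q)) powr q = K powr q * exp (R x)"
        using K q by (simp add: powr_mult exp_powr_real)
      finally have "ennreal (gauss_const * exp (- R x)) * ennpow (ou_maximal Q B f x) q \<le>
          ennreal (gauss_const * exp (- R x)) * (ennreal (K powr q * exp (R x)) * ennpow ?h q)"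
        by (intro mult_left_mono) auto
      also have "\<dots> = ennreal (gauss_const * exp (- R x) * (K powr q * exp (R x))) * ennpow ?h q"
        using gauss_const_pos by (simp add: ennreal_mult' mult.assoc)
      also have "gauss_const * exp (- R x) * (K powr q * exp (R x)) = gauss_const * K powr q"
        by (simp add: exp_minus)
      finally show "ennreal (gauss_const * exp (- R x)) * ennpow (ou_maximal Q B f x) q \<le>
          ennreal (gauss_const * K powr q) * ennpow ?h q" .
    qed
    also have "\<dots> = ennreal (gauss_const * K powr q) * (\<integral>\<^sup>+x. ennpow (hl_maximal (\<lambda>u. ennreal (g u)) x) q \<partial>lborel)"
      by (rule nn_integral_cmult) measurable
    also have "\<dots> \<le> ennreal (gauss_const * K powr q) * (ennreal H * (\<integral>\<^sup>+x. ennreal (g x powr q) \<partial>lborel))"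
      unfolding H_def V_def by (intro mult_left_mono hl_maximal_strong_type g g0 q) simp
    also have "\<dots> = ennreal (K powr q * H) * (ennreal gauss_const * (\<integral>\<^sup>+x. ennreal (g x powr q) \<partial>lborel))"
      using gauss_const_pos H by (simp add: ennreal_mult' mult_ac)
    also have "ennreal gauss_const * (\<integral>\<^sup>+x. ennreal (g x powr q) \<partial>lborel) =
        (\<integral>\<^sup>+x. ennreal gauss_const * ennreal (g x powr q) \<partial>lborel)"
      by (rule nn_integral_cmult[symmetric]) measurable
    also have "\<dots> = (\<integral>\<^sup>+x. ennreal (gauss_const * exp (- R x)) * ennpow (ennreal (norm (f x))) q \<partial>lborel)"
      using gauss_const_pos q
      by (intro nn_integral_cong) (simp add: g_def ennpow_ennreal powr_mult exp_powr_real mult_ac flip: ennreal_mult')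
    also have "\<dots> = (\<integral>\<^sup>+x. ennpow (ennreal (norm (f x))) q \<partial>\<gamma>)"
      by (rule nn_integral_gauss[symmetric]) measurable
    finally show ?thesis .
  qed
  moreover have "K powr q * H > 0" using K H by simp
  ultimately show ?thesis using that by blast
qed

text \<open>On a finite measure space, from \<open>s \<le> 1 + s powr q\<close>. Integrability is
  what the measurability of the maximal function rests on.\<close>

lemma integrable_if_Lq:
  assumes q: "q > 1" and [measurable]: "f \<in> borel_measurable borel"
    and fin: "(\<integral>\<^sup>+x. ennpow (ennreal (norm (f x))) q \<partial>\<gamma>) < top"
  shows "integrable \<gamma> (f :: real^'n \<Rightarrow> complex)"
proof (rule integrableI_bounded)
  interpret finite_measure \<gamma> by (rule finite_gauss)
  have fu: "emeasure \<gamma> UNIV < top" using emeasure_finite[of UNIV] unfolding infinity_ennreal_def less_top .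
  have [measurable]: "(\<lambda>a. ennpow a q) \<in> borel_measurable borel"
    unfolding ennpow_def by measurable
  have "(\<integral>\<^sup>+x. ennreal (norm (f x)) \<partial>\<gamma>) \<le> (\<integral>\<^sup>+x. 1 + ennpow (ennreal (norm (f x))) q \<partial>\<gamma>)"
  proof (rule nn_integral_mono)
    fix x
    have "norm (f x) \<le> 1 + norm (f x) powr q"
    proof (cases "norm (f x) \<le> 1")
      case False
      then have "norm (f x) powr 1 \<le> norm (f x) powr q" using q by (intro powr_mono) auto
      then show ?thesis using False by simp
    qed (simp add: add_increasing2)
    then show "ennreal (norm (f x)) \<le> 1 + ennpow (ennreal (norm (f x))) q"
      by (simp add: ennpow_ennreal ennreal_leI flip: ennreal_1 ennreal_plus)
  qed
  also have "\<dots> = emeasure \<gamma> (space \<gamma>) + (\<integral>\<^sup>+x. ennpow (ennreal (norm (f x))) q \<partial>\<gamma>)"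
    by (subst nn_integral_add) auto
  also have "\<dots> < \<infinity>" using fin fu by simp
  finally show "(\<integral>\<^sup>+x. ennreal (norm (f x)) \<partial>\<gamma>) < \<infinity>" .
qed measurable

section \<open>The operator bounds for finite and infinite exponents\<close>

lemma bounded_on_Lq:
  assumes p: "1 < p" "p < top"
  shows "bounded_on_Lp p \<gamma> (ou_maximal Q B)"
proof -
  define q where "q = enn2real p"
  have q: "q > 1" using p by (cases p) (auto simp: q_def ennreal_less_iff simp flip: ennreal_1)
  have q0: "0 < 1 / q" using q by simp
  obtain Z where Z: "Z > 0" and bd: "\<And>f. integrable \<gamma> f \<Longrightarrow>
      (\<integral>\<^sup>+x. ennpow (ou_maximal Q B f x) q \<partial>\<gamma>) \<le> ennreal Z * (\<integral>\<^sup>+x. ennpow (ennreal (norm (f x))) q \<partial>\<gamma>)"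
    using maximal_Lq_bound[OF q] by metis
  have Lp: "Lp_norm p \<gamma> g = ennpow (\<integral>\<^sup>+x. ennpow (g x) q \<partial>\<gamma>) (1 / q)" for g
    using less_imp_neq[OF p(2)] by (simp add: Lp_norm_def q_def)
  show ?thesis unfolding bounded_on_Lp_def
  proof (intro exI[of _ "Z powr (1 / q)"] allI impI conjI)
    fix f :: "real^'n \<Rightarrow> complex"
    assume f: "f \<in> borel_measurable \<gamma>" and fin: "Lp_norm p \<gamma> (\<lambda>x. ennreal (norm (f x))) < top"
    \<comment> \<open>Since \<open>ennpow top\<close> is \<open>top\<close>, a finite norm forces a
      finite integral.\<close>
    have "(\<integral>\<^sup>+x. ennpow (ennreal (norm (f x))) q \<partial>\<gamma>) \<noteq> top"
      using fin unfolding Lp by auto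
    then have int: "integrable \<gamma> f"
      using f by (intro integrable_if_Lq[OF q]) (auto simp: less_top)
    then show "ou_maximal Q B f \<in> borel_measurable \<gamma>" by (rule maximal_measurable)
    have "Lp_norm p \<gamma> (ou_maximal Q B f) \<le> ennpow (ennreal Z * (\<integral>\<^sup>+x. ennpow (ennreal (norm (f x))) q \<partial>\<gamma>)) (1 / q)"
      unfolding Lp using q0 by (intro ennpow_mono bd int) simp
    also have "\<dots> = ennreal (Z powr (1 / q)) * Lp_norm p \<gamma> (\<lambda>x. ennreal (norm (f x)))"
      unfolding Lp by (rule ennpow_mult[OF Z q0])
    finally show "Lp_norm p \<gamma> (ou_maximal Q B f) \<le> ennreal (Z powr (1 / q)) * Lp_norm p \<gamma> (\<lambda>x. ennreal (norm (f x)))" .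
  qed
qed

text \<open>The kernel times the density of \<gamma> has Lebesgue mass bounded uniformly in
  \<open>t\<close> and \<open>x\<close>, so the essential supremum of \<open>f\<close> can be taken
  out of the integral. The resulting bound holds at every point \<open>x\<close>.\<close>

lemma bounded_on_Linfty: "bounded_on_Lp top \<gamma> (ou_maximal Q B)"
proof -
  obtain C d where C: "C > 0" and d: "d > 0" and ker:
    "\<And>t x y. t > 0 \<Longrightarrow> \<bar>mehler_kernel Q B t x y\<bar> * exp (- R y) \<le>
       C / sqrt (min 1 t) ^ CARD('n) * exp (- d * (norm (y - M t *v x))\<^sup>2 / min 1 t)"
    using mehler_weighted_le by metis
  obtain A where A: "A > 0" and mass: "\<And>s x :: real^'n. s > 0 \<Longrightarrow>
      (\<integral>\<^sup>+y. ennreal (exp (- d * (norm (x - y))\<^sup>2 / s) / sqrt s ^ DIM(real^'n)) \<partial>lborel) \<le> ennreal A"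
    using gaussian_mass_bound[where 'a = "real^'n", OF d] by metis
  show ?thesis unfolding bounded_on_Lp_def
  proof (intro exI[of _ "gauss_const * C * A"] allI impI conjI)
    fix f :: "real^'n \<Rightarrow> complex"
    assume f: "f \<in> borel_measurable \<gamma>" and fin: "Lp_norm top \<gamma> (\<lambda>x. ennreal (norm (f x))) < top"
    have m[measurable]: "f \<in> borel_measurable borel" using f by simp
    define c where "c = esssup \<gamma> (\<lambda>x. ennreal (norm (f x)))"
    have c: "c < top" using fin by (simp add: Lp_norm_def c_def)
    have AE: "AE u in \<gamma>. ennreal (norm (f u)) \<le> c" unfolding c_def by (rule esssup_AE)
    \<comment> \<open>The density of \<gamma> is strictly positive, so its null sets are Lebesgue
      null.\<close>
    have AEl: "AE u in lborel. ennreal (norm (f u)) \<le> c"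
      using AE gauss_const_pos unfolding gauss_eq by (subst (asm) AE_density) auto
    interpret finite_measure \<gamma> by (rule finite_gauss)
    have fu: "emeasure \<gamma> UNIV < top" using emeasure_finite[of UNIV] unfolding infinity_ennreal_def less_top .
    have "integrable \<gamma> f"
    proof (rule integrableI_bounded)
      have "(\<integral>\<^sup>+x. ennreal (norm (f x)) \<partial>\<gamma>) \<le> (\<integral>\<^sup>+x. c \<partial>\<gamma>)" by (intro nn_integral_mono_AE AE)
      also have "\<dots> < \<infinity>" using c fu by (simp add: ennreal_mult_less_top)
      finally show "(\<integral>\<^sup>+x. ennreal (norm (f x)) \<partial>\<gamma>) < \<infinity>" .
    qed measurable
    then show meas: "ou_maximal Q B f \<in> borel_measurable \<gamma>" by (rule maximal_measurable)
    have "ou_maximal Q B f x \<le> ennreal (gauss_const * C * A) * c" for x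
      unfolding ou_maximal_def
    proof (rule SUP_least)
      fix t :: real assume "t \<in> {0<..}"
      then have t: "t > 0" by simp
      let ?G = "\<lambda>u. exp (- d * (norm (M t *v x - u))\<^sup>2 / min 1 t) / sqrt (min 1 t) ^ DIM(real^'n)"
      have "ennreal (norm (ou_semigroup Q B t f x)) \<le>
        (\<integral>\<^sup>+u. ennreal (gauss_const * (\<bar>mehler_kernel Q B t x u\<bar> * exp (- R u))) * ennreal (norm (f u)) \<partial>lborel)"
        by (rule norm_semigroup_le) measurable
      also have "\<dots> \<le> (\<integral>\<^sup>+u. (ennreal (gauss_const * C) * c) * ennreal (?G u) \<partial>lborel)"
      proof (rule nn_integral_mono_AE, use AEl in eventually_elim)
        fix u assume u: "ennreal (norm (f u)) \<le> c"
        have "gauss_const * (\<bar>mehler_kernel Q B t x u\<bar> * exp (- R u)) \<le> gauss_const * (C * ?G u)"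
          using ker[OF t, of x u] gauss_const_pos by (intro mult_left_mono) (auto simp: norm_minus_commute)
        then have "ennreal (gauss_const * (\<bar>mehler_kernel Q B t x u\<bar> * exp (- R u))) * ennreal (norm (f u)) \<le>
            ennreal (gauss_const * (C * ?G u)) * c"
          using u by (intro mult_mono[OF ennreal_leI]) auto
        also have "\<dots> = (ennreal (gauss_const * C) * c) * ennreal (?G u)"
        proof -
          have "ennreal (gauss_const * (C * ?G u)) = ennreal (gauss_const * C) * ennreal (?G u)"
            using gauss_const_pos C by (subst ennreal_mult'[symmetric]) (auto simp: mult.assoc)
          then show ?thesis by (simp only: mult_ac)
        qed
        finally show "ennreal (gauss_const * (\<bar>mehler_kernel Q B t x u\<bar> * exp (- R u))) * ennreal (norm (f u)) \<le> \<dots>" .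
      qed
      also have "\<dots> = (ennreal (gauss_const * C) * c) * (\<integral>\<^sup>+u. ennreal (?G u) \<partial>lborel)"
        by (rule nn_integral_cmult) measurable
      also have "\<dots> \<le> (ennreal (gauss_const * C) * c) * ennreal A"
        using t by (intro mult_left_mono mass) auto
      also have "\<dots> = ennreal (gauss_const * C * A) * c"
        using gauss_const_pos C A by (simp add: ennreal_mult' mult_ac)
      finally show "ennreal (norm (ou_semigroup Q B t f x)) \<le> ennreal (gauss_const * C * A) * c" .
    qed
    then have "esssup \<gamma> (ou_maximal Q B f) \<le> ennreal (gauss_const * C * A) * c"
      by (intro esssup_I meas) auto
    then show "Lp_norm top \<gamma> (ou_maximal Q B f) \<le> ennreal (gauss_const * C * A) * Lp_norm top \<gamma> (\<lambda>x. ennreal (norm (f x)))"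
      by (simp add: Lp_norm_def c_def)
  qed
qed

end

theorem corollary1p2:
  fixes Q B :: "real^'n^'n"
  assumes "sym_pos_def Q"
    and "\<And>z. eigenvalue_of B z \<Longrightarrow> Re z < 0"
  shows "\<forall>p::ennreal. 1 < p \<longrightarrow> bounded_on_Lp p (ou_gauss Q B \<infinity>) (ou_maximal Q B)"
proof (intro allI impI)
  fix p :: ennreal
  assume p: "1 < p"
  interpret ou_data Q B using assms by unfold_locales
  show "bounded_on_Lp p (ou_gauss Q B \<infinity>) (ou_maximal Q B)"
    using bounded_on_Lq[OF p] bounded_on_Linfty by (cases "p = top") (auto simp: less_top)
qed

end
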